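(* Let $C\subset\mathbb{P}^2$ be a unicuspidal rational curve with distinguished point $P$, and let $\Lambda_C$ be the associated pencil. Then $\Lambda_C$ is the unique pencil on $\mathbb{P}^2$ satisfying $C\in\Lambda_C$ and $\mathrm{Bs}(\Lambda_C)=\{P\}$.
   Context: All varieties are over an algebraically closed field $\mathbf{k}$ of characteristic zero; curves are irreducible and reduced. A unicuspidal rational curve is a pair $(C,P)$ where $C$ is a curve and $P\in C$ is a point (the distinguished point) such that $C\setminus\{P\}\cong\mathbb{A}^1$. Let $d=\deg C$. $\Lambda_C$ is the set of effective divisors $D$ of $\mathbb{P}^2$ with $\deg D=d$ and $i_P(C,D)\ge d^2$, where $i_P(C,D)$ is the local intersection number of $C$ and $D$ at $P$ (equal to $+\infty$ if $C$ is a component of $D$). $\Lambda_C$ is a pencil, i.e. a linear system of dimension 1. $\mathrm{Bs}(\Lambda)$ denotes the base locus of the linear system $\Lambda$ on $\mathbb{P}^2$ (the set of points lying in the support of every member of $\Lambda$). *)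

theory Defs
  imports "HOL-Analysis.Abstract_Topology" "HOL-Computational_Algebra.Polynomial"
    "HOL-Computational_Algebra.Fraction_Field"
    "HOL-Library.Extended_Nat"
begin

subsection \<open>Forms in three variables\<close>

text \<open>The polynomial ring $k[X,Y,Z]$ is rendered as $k[X][Y][Z]$: the outermost variable is $Z$,
  the innermost one is $X$.\<close>

type_synonym 'a poly3 = "'a poly poly poly"

definition const3 :: "'a::comm_ring_1 \<Rightarrow> 'a poly3" where
  "const3 c = [:[:[:c:]:]:]"

definition scale3 :: "'a::comm_ring_1 \<Rightarrow> 'a poly3 \<Rightarrow> 'a poly3" where
  "scale3 c F = const3 c * F"

fun eval3 :: "'a::comm_ring_1 poly3 \<Rightarrow> 'a \<times> 'a \<times> 'a \<Rightarrow> 'a" where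
  "eval3 F (x, y, z) = poly (poly (poly F [:[:z:]:]) [:y:]) x"

definition forms :: "nat \<Rightarrow> 'a::comm_ring_1 poly3 set" where
  "forms n = {F. \<forall>i j k. coeff (coeff (coeff F k) j) i \<noteq> 0 \<longrightarrow> i + j + k = n}"

lemma const3_add: "const3 (a + b) = const3 a + const3 b"
  and const3_mult: "const3 (a * b) = const3 a * const3 b"
  and const3_1: "const3 1 = 1"
  by (simp_all add: const3_def one_pCons)

lemma formsD: "F \<in> forms n \<Longrightarrow> coeff (coeff (coeff F k) j) i \<noteq> 0 \<Longrightarrow> i + j + k = n"
  by (simp add: forms_def)

lemma vector_space_scale3: "vector_space (scale3 :: 'a::field \<Rightarrow> 'a poly3 \<Rightarrow> 'a poly3)"
  by unfold_locales
     (simp_all add: scale3_def const3_add const3_mult const3_1 distrib_left distrib_right mult.assoc)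

lemma coeff_scale3: "coeff (coeff (coeff (scale3 c F) k) j) i = c * coeff (coeff (coeff F k) j) i"
  by (simp add: scale3_def const3_def)

subsection \<open>The projective plane and its Zariski topology\<close>

text \<open>A point of the plane is the set of all its triples of homogeneous coordinates.\<close>

type_synonym 'a point = "('a \<times> 'a \<times> 'a) set"

definition hpoint :: "'a::field \<Rightarrow> 'a \<Rightarrow> 'a \<Rightarrow> 'a point" where
  "hpoint x y z = {(c * x, c * y, c * z) | c. c \<noteq> 0}"

definition proj_plane :: "'a::field point set" where
  "proj_plane = {hpoint x y z | x y z. (x, y, z) \<noteq> (0, 0, 0)}"

definition vanishes_at :: "'a::field poly3 \<Rightarrow> 'a point \<Rightarrow> bool" where
  "vanishes_at F p \<longleftrightarrow> (\<forall>v\<in>p. eval3 F v = 0)"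

definition zariski_plane :: "'a::field point topology" where
  "zariski_plane =
     topology_generated_by {{p \<in> proj_plane. \<not> vanishes_at F p} | F n. F \<in> forms n}"

lemma not_vanishes_at_1:
  assumes "p \<in> proj_plane"
  shows "\<not> vanishes_at 1 p"
proof -
  obtain x y z where "p = hpoint x y z"
    using assms unfolding proj_plane_def by blast
  moreover have "\<exists>c. (x, y, z) = (c * x, c * y, c * z) \<and> c \<noteq> 0"
    by (rule exI[of _ 1]) simp
  ultimately have "(x, y, z) \<in> p"
    by (simp only: hpoint_def mem_Collect_eq)
  moreover have "eval3 1 (x, y, z) \<noteq> 0"
    by simp
  ultimately show ?thesis
    unfolding vanishes_at_def by metis
qed

lemma topspace_zariski_plane: "topspace zariski_plane = (proj_plane :: 'a::field point set)"
  unfolding zariski_plane_def topology_generated_by_topspace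
proof (intro equalityI subsetI)
  fix p :: "'a point"
  assume p: "p \<in> proj_plane"
  have "(1 :: 'a poly3) \<in> forms 0"
    by (simp add: forms_def)
  then have "{p \<in> proj_plane. \<not> vanishes_at (1 :: 'a poly3) p} \<in>
      {{p \<in> proj_plane. \<not> vanishes_at F p} | (F :: 'a poly3) n. F \<in> forms n}"
    unfolding mem_Collect_eq by (intro exI conjI) (rule refl)
  moreover have "p \<in> {p \<in> proj_plane. \<not> vanishes_at (1 :: 'a poly3) p}"
    using p not_vanishes_at_1 by simp
  ultimately show "p \<in> \<Union>{{p \<in> proj_plane. \<not> vanishes_at F p} | (F :: 'a poly3) n. F \<in> forms n}"
    by (rule UnionI)
qed (elim UnionE CollectE exE conjE, simp)

subsection \<open>Regular functions, morphisms and isomorphisms\<close>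

text \<open>If $U$ is open in a subvariety $Y$ of the plane, then the subsets of $U$ that are open in
  $Y$ are the subsets that are open in $U$; so $Y$ need not be mentioned.
  Only the values of \<open>f\<close> on \<open>U\<close> matter.\<close>

definition regular_plane :: "'a::field point set \<Rightarrow> ('a point \<Rightarrow> 'a) \<Rightarrow> bool" where
  "regular_plane U f \<longleftrightarrow>
     (\<forall>p\<in>U. \<exists>V. openin (subtopology zariski_plane U) V \<and> p \<in> V \<and>
        (\<exists>n. \<exists>G\<in>forms n. \<exists>H\<in>forms n. \<forall>q\<in>V. \<forall>v\<in>q.
           eval3 H v \<noteq> 0 \<and> f q = eval3 G v / eval3 H v))"

definition zariski_line :: "'a::field topology" where
  "zariski_line = topology_generated_by {{t. poly h t \<noteq> 0} | h. True}"

definition regular_line :: "'a::field set \<Rightarrow> ('a \<Rightarrow> 'a) \<Rightarrow> bool" where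
  "regular_line U f \<longleftrightarrow>
     (\<forall>t\<in>U. \<exists>V. openin (subtopology zariski_line U) V \<and> t \<in> V \<and>
        (\<exists>g h. \<forall>s\<in>V. poly h s \<noteq> 0 \<and> f s = poly g s / poly h s))"

text \<open>A morphism is a continuous map that pulls back regular functions to regular functions;
  a variety is given by its topology and the predicate ``regular on the open set $U$''.\<close>

definition morphism ::
  "'p topology \<Rightarrow> ('p set \<Rightarrow> ('p \<Rightarrow> 'a) \<Rightarrow> bool) \<Rightarrow> 'q topology \<Rightarrow> ('q set \<Rightarrow> ('q \<Rightarrow> 'a) \<Rightarrow> bool)
     \<Rightarrow> ('p \<Rightarrow> 'q) \<Rightarrow> bool" where
  "morphism X regX Y regY \<phi> \<longleftrightarrow> continuous_map X Y \<phi> \<and>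
     (\<forall>U f. openin Y U \<and> regY U f \<longrightarrow> regX {x \<in> topspace X. \<phi> x \<in> U} (f \<circ> \<phi>))"

definition isomorphic_to_affine_line :: "'a::field point set \<Rightarrow> bool" where
  "isomorphic_to_affine_line Y \<longleftrightarrow>
     (\<exists>\<phi> \<psi>. morphism zariski_line regular_line (subtopology zariski_plane Y) regular_plane \<phi> \<and>
            morphism (subtopology zariski_plane Y) regular_plane zariski_line regular_line \<psi> \<and>
            (\<forall>t. \<psi> (\<phi> t) = t) \<and> (\<forall>p\<in>Y. \<phi> (\<psi> p) = p))"

subsection \<open>Effective divisors and linear systems\<close>

text \<open>An effective divisor of degree $n$ on the plane is a nonzero form of degree $n$ up to
  nonzero scalars; it is represented by the set of all its equations.\<close>

type_synonym 'a divisor = "'a poly3 set"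

definition div_of :: "'a::field poly3 \<Rightarrow> 'a divisor" where
  "div_of F = {scale3 c F | c. c \<noteq> 0}"

definition effective_divisors :: "nat \<Rightarrow> 'a::field divisor set" where
  "effective_divisors n = div_of ` (forms n - {0})"

definition divisor_degree :: "'a::field divisor \<Rightarrow> nat" where
  "divisor_degree D = (THE n. D \<in> effective_divisors n)"

lemma forms_degree_unique:
  assumes "F \<in> forms n" "F \<in> forms m" "F \<noteq> 0"
  shows "m = n"
proof -
  define p where "p = lead_coeff F"
  define q where "q = lead_coeff p"
  have "q \<noteq> 0"
    using assms(3) by (simp add: p_def q_def)
  then have "coeff (coeff (coeff F (degree F)) (degree p)) (degree q) \<noteq> 0"
    by (simp add: p_def q_def)
  then have "degree q + degree p + degree F = n" "degree q + degree p + degree F = m"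
    using formsD[OF assms(1)] formsD[OF assms(2)] by blast+
  then show ?thesis
    by simp
qed

lemma self_in_div_of: "F \<in> div_of F"
proof -
  have "F = scale3 1 F \<and> (1 :: 'a) \<noteq> 0"
    by (simp add: scale3_def const3_1)
  then show ?thesis
    unfolding div_of_def mem_Collect_eq by (rule exI)
qed

lemma div_of_subset_forms:
  assumes "F \<in> forms n"
  shows "div_of F \<subseteq> forms n"
  using assms by (auto simp: div_of_def forms_def coeff_scale3)

lemma divisor_degree_div_of:
  assumes "F \<in> forms n" "F \<noteq> 0"
  shows "divisor_degree (div_of F) = n"
  unfolding divisor_degree_def
proof (rule the_equality)
  show "div_of F \<in> effective_divisors n"
    unfolding effective_divisors_def using assms by (intro imageI) simp
next
  fix m assume "div_of F \<in> effective_divisors m"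
  then obtain G where G: "G \<in> forms m" "div_of F = div_of G"
    unfolding effective_divisors_def by blast
  have "F \<in> forms m"
    using self_in_div_of[of F] div_of_subset_forms[OF G(1)] unfolding G(2) by (rule rev_subsetD)
  then show "m = n"
    using forms_degree_unique[OF assms(1) _ assms(2)] by simp
qed

definition supp :: "'a::field divisor \<Rightarrow> 'a point set" where
  "supp D = {p \<in> proj_plane. \<forall>F\<in>D. vanishes_at F p}"

text \<open>Irreducible and reduced plane curves, i.e. the prime divisors.\<close>

definition plane_curve :: "'a::field divisor \<Rightarrow> bool" where
  "plane_curve C \<longleftrightarrow> (\<exists>n. \<exists>F\<in>forms n. irreducible F \<and> C = div_of F)"

definition linear_system :: "nat \<Rightarrow> 'a::field divisor set \<Rightarrow> bool" where
  "linear_system r \<Lambda> \<longleftrightarrow>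
     (\<exists>n V. V \<subseteq> forms n \<and> module.subspace scale3 V \<and> vector_space.dim scale3 V = r + 1 \<and>
        \<Lambda> = div_of ` (V - {0}))"

definition pencil :: "'a::field divisor set \<Rightarrow> bool" where
  "pencil \<Lambda> \<longleftrightarrow> linear_system 1 \<Lambda>"

definition base_locus :: "'a::field divisor set \<Rightarrow> 'a point set" where
  "base_locus \<Lambda> = {p \<in> proj_plane. \<forall>D\<in>\<Lambda>. p \<in> supp D}"

subsection \<open>Local intersection numbers\<close>

text \<open>The local ring of the plane at $P$, inside the fraction field of $k[X,Y,Z]$.\<close>

definition local_ring :: "'a::field point \<Rightarrow> 'a poly3 fract set" where
  "local_ring P = {Fract G H | G H n. G \<in> forms n \<and> H \<in> forms n \<and> \<not> vanishes_at H P}"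

text \<open>The local equations at $P$ of a divisor; any two of them differ by a unit of the local
  ring.\<close>

definition local_equations :: "'a::field point \<Rightarrow> 'a divisor \<Rightarrow> 'a poly3 fract set" where
  "local_equations P D =
     {Fract F H | F H n. F \<in> D \<and> F \<in> forms n \<and> H \<in> forms n \<and> \<not> vanishes_at H P}"

definition intersection_ideal ::
  "'a::field point \<Rightarrow> 'a divisor \<Rightarrow> 'a divisor \<Rightarrow> 'a poly3 fract set" where
  "intersection_ideal P C D =
     {a * f + b * g | a b f g. a \<in> local_ring P \<and> b \<in> local_ring P \<and>
        f \<in> local_equations P C \<and> g \<in> local_equations P D}"

definition independent_modulo ::
  "'a::field poly3 fract set \<Rightarrow> 'a poly3 fract set \<Rightarrow> bool" where
  "independent_modulo I B \<longleftrightarrow>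
     (\<forall>c. (\<Sum>b\<in>B. Fract (const3 (c b)) 1 * b) \<in> I \<longrightarrow> (\<forall>b\<in>B. c b = 0))"

text \<open>The dimension over $k$ of the local ring modulo the ideal generated by local equations
  of $C$ and $D$.\<close>

definition intersection_number :: "'a::field point \<Rightarrow> 'a divisor \<Rightarrow> 'a divisor \<Rightarrow> enat" where
  "intersection_number P C D =
     Sup {enat (card B) | B. finite B \<and> B \<subseteq> local_ring P \<and>
            independent_modulo (intersection_ideal P C D) B}"

subsection \<open>Unicuspidal rational curves and the associated pencil\<close>

definition unicuspidal_rational_curve :: "'a::field divisor \<Rightarrow> 'a point \<Rightarrow> bool" where
  "unicuspidal_rational_curve C P \<longleftrightarrow>
     plane_curve C \<and> P \<in> supp C \<and> isomorphic_to_affine_line (supp C - {P})"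

definition assoc_pencil :: "'a::field divisor \<Rightarrow> 'a point \<Rightarrow> 'a divisor set" where
  "assoc_pencil C P =
     {D \<in> effective_divisors (divisor_degree C).
        intersection_number P C D \<ge> enat ((divisor_degree C)\<^sup>2)}"

end

theory Submission
  imports Defs "Berlekamp_Zassenhaus.Unique_Factorization_Poly"
begin

text \<open>
  Let \<open>F\<close> be the equation of \<open>C\<close>, of degree \<open>d\<close>. The isomorphism of the affine line with \<open>C\<close> without \<open>P\<close> is
  given by three polynomials in \<open>t\<close> without common root, and \<open>P\<close> is the point at infinity of this
  parametrization. Substitution \<open>\<rho>\<close> maps the forms of degree \<open>n\<close> onto a space \<open>W n\<close> of polynomials of
  degree at most \<open>n * d\<close>, with kernel the multiples of \<open>F\<close>, so \<open>W n\<close> has codimension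
  \<open>\<delta> = (d - 1) * (d - 2) / 2\<close> for \<open>n \<ge> d\<close>; moreover \<open>n * d - degree (\<rho> G)\<close> is the order of \<open>G\<close> at \<open>P\<close>.
  As \<open>t\<close> is regular on \<open>C\<close> without \<open>P\<close>, every polynomial of sufficiently high order at \<open>P\<close> lies in \<open>W n\<close>.
  Hence the orders form a numerical semigroup with \<open>\<delta>\<close> gaps, all of them below \<open>2 * \<delta> < d\<^sup>2\<close>, and
  some form \<open>G\<close> of degree \<open>d\<close> has order \<open>d\<^sup>2\<close>, which means that \<open>\<rho> G\<close> is a nonzero constant. A form \<open>G\<close> of
  degree \<open>d\<close> satisfies \<open>i\<^sub>P(C, G) \<ge> d\<^sup>2\<close> if and only if \<open>\<rho> G\<close> is constant; these forms make up a
  two-dimensional space containing \<open>F\<close>. Conversely, if a pencil contains \<open>C\<close> and has no base point other than \<open>P\<close>, then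
  for each of its members \<open>G\<close> that are not multiples of \<open>F\<close> the polynomial \<open>\<rho> G\<close> has no root.
\<close>

subsection \<open>Linear algebra\<close>

context vector_space
begin

text \<open>The ambient spaces are infinite-dimensional, and \<open>dim\<close> is 0 for a subspace
  with an infinite basis. Finiteness is therefore carried along as inclusion in the span of a finite
  set \<open>T\<close>.\<close>

lemma finite_basis:
  assumes "V \<subseteq> span T" "finite T"
  obtains A where "A \<subseteq> V" "independent A" "V \<subseteq> span A" "card A = dim V" "finite A"
proof -
  obtain A where A: "A \<subseteq> V" "independent A" "V \<subseteq> span A" "card A = dim V"
    by (rule basis_exists)
  moreover have "finite A"
    using independent_span_bound[OF assms(2) A(2)] A(1) assms(1) by blast
  ultimately show thesis by (rule that)
qed

lemma independent_card_le:
  assumes "independent B" "B \<subseteq> V" "V \<subseteq> span T" "finite T"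
  shows "card B \<le> dim V"
proof -
  obtain A where A: "A \<subseteq> V" "independent A" "V \<subseteq> span A" "card A = dim V" "finite A"
    by (rule finite_basis[OF assms(3,4)])
  then show ?thesis
    using independent_span_bound[OF A(5) assms(1)] assms(2) by auto
qed

lemma dim_subset_fin:
  assumes "U \<subseteq> V" "V \<subseteq> span T" "finite T"
  shows "dim U \<le> dim V"
proof -
  obtain A where "A \<subseteq> U" "independent A" "card A = dim U"
    by (rule finite_basis[of U T]) (use assms in auto)
  then show ?thesis
    using independent_card_le[of A V T] assms by auto
qed

lemma dim_less:
  assumes "subspace U" "U \<subseteq> V" "x \<in> V" "x \<notin> U" "V \<subseteq> span T" "finite T"
  shows "dim U < dim V"
proof -
  obtain A where A: "A \<subseteq> U" "independent A" "card A = dim U" "finite A"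
    by (rule finite_basis[of U T]) (use assms in auto)
  have "x \<notin> span A"
    using span_minimal[OF A(1) assms(1)] assms(4) by blast
  then have "independent (insert x A)" "x \<notin> A"
    using A(2) by (auto simp: independent_insertI span_base)
  then have "card (insert x A) \<le> dim V"
    using independent_card_le[of "insert x A" V T] A(1) assms by auto
  then show ?thesis
    using A \<open>x \<notin> A\<close> by simp
qed

text \<open>Independence in the quotient of \<open>V\<close> by \<open>U\<close>, without forming
  the quotient: adjoining the vectors to \<open>U\<close> one at a time raises the dimension by at
  least one each time.\<close>

lemma independent_family_modulo:
  assumes "finite I" "subspace U" "U \<subseteq> V" "v ` I \<subseteq> V" "subspace V" "V \<subseteq> span T" "finite T"
    and "\<And>c. (\<Sum>i\<in>I. scale (c i) (v i)) \<in> U \<Longrightarrow> \<forall>i\<in>I. c i = 0"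
  shows "dim U + card I \<le> dim V"
  using assms(1-4,8)
proof (induction I arbitrary: U rule: finite_induct)
  case empty
  then show ?case
    using dim_subset_fin[of U V T] assms by auto
next
  case (insert a I)
  define U' where "U' = span (insert (v a) U)"
  have notin: "v a \<notin> U"
  proof
    assume "v a \<in> U"
    moreover have "(\<Sum>i\<in>I. scale (if i = a then 1 else 0) (v i)) = 0"
      using insert.hyps by (intro sum.neutral) auto
    ultimately have "(\<Sum>i\<in>insert a I. scale (if i = a then 1 else 0) (v i)) \<in> U"
      using insert.hyps by simp
    from insert.prems(4)[OF this] show False by auto
  qed
  have sub: "U' \<subseteq> V"
    unfolding U'_def using insert.prems assms by (intro span_minimal) auto
  have "dim U' + card I \<le> dim V"
  proof (rule insert.IH)
    fix c
    assume "(\<Sum>i\<in>I. scale (c i) (v i)) \<in> U'"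
    then obtain k where "(\<Sum>i\<in>I. scale (c i) (v i)) - scale k (v a) \<in> span U"
      unfolding U'_def span_breakdown_eq by blast
    then have k: "(\<Sum>i\<in>I. scale (c i) (v i)) - scale k (v a) \<in> U"
      using insert.prems(1) by (metis span_eq_iff)
    \<comment> \<open>Giving \<open>v a\<close> the coefficient \<open>- k\<close> turns a relation
      modulo \<open>U'\<close> into one modulo \<open>U\<close>.\<close>
    have "(\<Sum>i\<in>insert a I. scale (if i = a then - k else c i) (v i)) =
        (\<Sum>i\<in>I. scale (c i) (v i)) - scale k (v a)"
      using insert.hyps by (simp add: scale_minus_left) (intro sum.cong, auto)
    then have "\<forall>i\<in>insert a I. (if i = a then - k else c i) = 0"
      using insert.prems(4)[of "\<lambda>i. if i = a then - k else c i"] k by simp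
    then show "\<forall>i\<in>I. c i = 0"
      using insert.hyps by (metis insertCI)
  qed (use insert.prems sub in \<open>auto simp: U'_def\<close>)
  moreover have "dim U < dim U'"
  proof (rule dim_less)
    show "U \<subseteq> U'" "v a \<in> U'" unfolding U'_def by (auto intro: span_base)
  qed (use insert.prems notin sub assms in auto)
  ultimately show ?case
    using insert.hyps by simp
qed

text \<open>Rank-nullity for the linear map \<nu>, with the rank read off from the degrees that
  occur in the image. Preimages of polynomials of distinct degrees are independent modulo the
  kernel, and subtracting multiples of them lowers the degree until the kernel is reached.\<close>

lemma dim_eq_card_degrees:
  fixes \<nu> :: "'b \<Rightarrow> 'a poly"
  assumes V: "subspace V" "V \<subseteq> span T" "finite T"
    and lin: "\<And>x y. \<nu> (x + y) = \<nu> x + \<nu> y" "\<And>c x. \<nu> (scale c x) = smult c (\<nu> x)"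
  shows "finite {degree (\<nu> x) | x. x \<in> V \<and> \<nu> x \<noteq> 0}"
    and "dim V = card {degree (\<nu> x) | x. x \<in> V \<and> \<nu> x \<noteq> 0} + dim {x \<in> V. \<nu> x = 0}"
proof -
  define E where "E = {degree (\<nu> x) | x. x \<in> V \<and> \<nu> x \<noteq> 0}"
  define K where "K = {x \<in> V. \<nu> x = 0}"
  have \<nu>0: "\<nu> 0 = 0"
    using lin(2)[of 0 0] by simp
  have \<nu>sum: "\<nu> (sum f A) = (\<Sum>a\<in>A. \<nu> (f a))" for f :: "nat \<Rightarrow> 'b" and A
    by (induction A rule: infinite_finite_induct) (auto simp: \<nu>0 lin)
  have \<nu>diff: "\<nu> (x - y) = \<nu> x - \<nu> y" for x y
    using lin(1)[of "x - y" y] by simp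
  have K: "subspace K"
    using V(1) unfolding K_def subspace_def by (auto simp: \<nu>0 lin)
  have "\<exists>g. \<forall>e\<in>E. g e \<in> V \<and> \<nu> (g e) \<noteq> 0 \<and> degree (\<nu> (g e)) = e"
    by (rule bchoice) (auto simp: E_def)
  then obtain g where g: "g e \<in> V" "\<nu> (g e) \<noteq> 0" "degree (\<nu> (g e)) = e" if "e \<in> E" for e
    by metis
  have le: "dim K + card I \<le> dim V" if "finite I" "I \<subseteq> E" for I
  proof (rule independent_family_modulo[of I K V g T])
    fix c
    assume "(\<Sum>i\<in>I. scale (c i) (g i)) \<in> K"
    then have eq: "(\<Sum>i\<in>I. smult (c i) (\<nu> (g i))) = 0"
      by (simp add: K_def \<nu>sum lin)
    show "\<forall>i\<in>I. c i = 0"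
    proof (rule ccontr)
      assume "\<not> (\<forall>i\<in>I. c i = 0)"
      \<comment> \<open>Only \<open>g m\<close> contributes to the coefficient at \<open>m\<close>:
        every other term with a nonzero scalar has smaller degree.\<close>
      define m where "m = Max {i \<in> I. c i \<noteq> 0}"
      have fin: "finite {i \<in> I. c i \<noteq> 0}" and ne: "{i \<in> I. c i \<noteq> 0} \<noteq> {}"
        using that \<open>\<not> _\<close> by auto
      have m: "m \<in> I" "c m \<noteq> 0"
        using Max_in[OF fin ne] unfolding m_def by auto
      have below: "coeff (smult (c i) (\<nu> (g i))) m = 0" if "i \<in> I" "i \<noteq> m" for i
      proof (cases "c i = 0")
        case False
        then have "i \<le> m"
          unfolding m_def using that fin by (intro Max_ge) auto
        then have "degree (\<nu> (g i)) < m"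
          using g(3) that \<open>I \<subseteq> E\<close> by (metis le_neq_implies_less subsetD)
        then show ?thesis
          by (simp add: coeff_eq_0)
      qed simp
      have "0 = coeff (\<Sum>i\<in>I. smult (c i) (\<nu> (g i))) m"
        by (simp add: eq)
      also have "\<dots> = (\<Sum>i\<in>I. coeff (smult (c i) (\<nu> (g i))) m)"
        by (rule coeff_sum)
      also have "\<dots> = coeff (smult (c m) (\<nu> (g m))) m + (\<Sum>i\<in>I - {m}. coeff (smult (c i) (\<nu> (g i))) m)"
        using m(1) that(1) by (rule sum.remove[rotated])
      also have "(\<Sum>i\<in>I - {m}. coeff (smult (c i) (\<nu> (g i))) m) = 0"
        using below by (intro sum.neutral) blast
      also have "coeff (smult (c m) (\<nu> (g m))) m + 0 = c m * lead_coeff (\<nu> (g m))"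
        using g(3)[of m] m that by auto
      finally show False
        using m g(2)[of m] that by auto
    qed
  qed (use that K V g in \<open>auto simp: K_def\<close>)
  show finE: "finite E"
  proof (rule ccontr)
    assume "infinite E"
    then obtain I where "finite I" "card I = Suc (dim V)" "I \<subseteq> E"
      by (meson infinite_arbitrarily_large)
    then show False
      using le[of I] by simp
  qed
  obtain A where A: "A \<subseteq> K" "independent A" "K \<subseteq> span A" "card A = dim K" "finite A"
    by (rule finite_basis[of K T]) (use V in \<open>auto simp: K_def\<close>)
  \<comment> \<open>The successor in the induction measure reserves the value 0 for elements of the
    kernel, so that passing from a nonzero constant image to the kernel still counts as a
    descent.\<close>
  have span: "x \<in> span (A \<union> g ` E)" if "x \<in> V" for x
    using that
  proof (induction "if \<nu> x = 0 then 0 else Suc (degree (\<nu> x))" arbitrary: x rule: less_induct)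
    case less
    show ?case
    proof (cases "\<nu> x = 0")
      case True
      then have "x \<in> span A"
        using less.prems A(3) by (auto simp: K_def)
      then show ?thesis
        using span_mono[of A "A \<union> g ` E"] by auto
    next
      case False
      define e where "e = degree (\<nu> x)"
      have e: "e \<in> E"
        unfolding E_def e_def using less.prems False by auto
      define c where "c = lead_coeff (\<nu> x) / lead_coeff (\<nu> (g e))"
      define w where "w = x - scale c (g e)"
      have w: "w \<in> V"
        unfolding w_def using less.prems g(1)[OF e] V(1) by (intro subspace_diff subspace_scale)
      have \<nu>w: "\<nu> w = \<nu> x - smult c (\<nu> (g e))"
        by (simp add: w_def \<nu>diff lin)
      have "coeff (\<nu> w) e = 0"
        using g(2)[OF e] by (metis \<nu>w c_def coeff_diff coeff_smult diff_self e_def g(3)[OF e] leading_coeff_0_iff nonzero_eq_divide_eq)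
      moreover have "degree (\<nu> w) \<le> e"
        unfolding \<nu>w using g(3)[OF e] by (intro degree_diff_le) (auto simp: e_def)
      ultimately have "\<nu> w = 0 \<or> degree (\<nu> w) < e"
        by (metis leading_coeff_0_iff le_neq_implies_less)
      then have "w \<in> span (A \<union> g ` E)"
        using less.hyps[of w] w False by (auto simp: e_def)
      moreover have "scale c (g e) \<in> span (A \<union> g ` E)"
        using e by (intro span_scale span_base) auto
      ultimately have "w + scale c (g e) \<in> span (A \<union> g ` E)"
        by (rule span_add)
      then show ?thesis
        by (simp add: w_def)
    qed
  qed
  have "dim V \<le> card (A \<union> g ` E)"
    using span A(5) finE by (intro dim_le_card) auto
  also have "\<dots> \<le> card A + card E"
    by (meson card_Un_le card_image_le finE le_trans add_left_mono)
  finally show "dim V = card E + dim K"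
    using le[OF finE] A(4) by simp
qed

end

subsection \<open>Forms\<close>

interpretation forms3: vector_space "scale3 :: 'a::field \<Rightarrow> 'a poly3 \<Rightarrow> 'a poly3"
  by (rule vector_space_scale3)

interpretation polys: vector_space "smult :: 'a::field \<Rightarrow> 'a poly \<Rightarrow> 'a poly"
  by unfold_locales (simp_all add: smult_add_right smult_add_left)

abbreviation coeff3 :: "'a::zero poly poly poly \<Rightarrow> nat \<Rightarrow> nat \<Rightarrow> nat \<Rightarrow> 'a" where
  "coeff3 F i j k \<equiv> coeff (coeff (coeff F k) j) i"

lemma poly3_eqI: "(\<And>i j k. coeff3 F i j k = coeff3 G i j k) \<Longrightarrow> F = G"
  by (intro poly_eqI) auto

definition monom3 :: "'a::comm_ring_1 \<Rightarrow> nat \<Rightarrow> nat \<Rightarrow> nat \<Rightarrow> 'a poly3" where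
  "monom3 c i j k = monom (monom (monom c i) j) k"

lemma coeff_monom3: "coeff3 (monom3 c i j k) i' j' k' = (if i' = i \<and> j' = j \<and> k' = k then c else 0)"
  by (auto simp: monom3_def coeff_monom)

lemma scale3_monom3: "scale3 c (monom3 a i j k) = monom3 (c * a) i j k"
  by (rule poly3_eqI) (simp add: coeff_scale3 coeff_monom3)

lemma scale3_monom3_1: "scale3 c (monom3 1 i j k) = monom3 c i j k"
  by (simp add: scale3_monom3)

lemma scale3_mult_left [simp]: "scale3 c F * G = scale3 c (F * G)"
  and scale3_mult_right [simp]: "F * scale3 c G = scale3 c (F * G)"
  by (simp_all add: scale3_def mult_ac)

lemma monom3_in_forms: "i + j + k = n \<Longrightarrow> monom3 c i j k \<in> forms n"
  unfolding forms_def by (auto simp: coeff_monom3 split: if_splits)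

lemma subspace_forms: "forms3.subspace (forms n)"
  unfolding forms3.subspace_def forms_def by (auto simp: coeff_scale3) (metis add.left_neutral)

lemmas forms_0 = forms3.subspace_0[OF subspace_forms]
  and forms_add = forms3.subspace_add[OF subspace_forms]
  and forms_diff = forms3.subspace_diff[OF subspace_forms]
  and forms_scale = forms3.subspace_scale[OF subspace_forms]
  and forms_sum = forms3.subspace_sum[OF subspace_forms]

lemma const3_in_forms: "const3 c \<in> forms 0"
  by (auto simp: forms_def const3_def coeff_pCons split: nat.splits)

lemma one_in_forms: "1 \<in> forms 0"
  using const3_in_forms[of 1] by (simp add: const3_1)

lemma forms_mult:
  assumes "F \<in> forms m" "G \<in> forms n"
  shows "F * G \<in> forms (m + n)"
  unfolding forms_def mem_Collect_eq
proof (intro allI impI)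
  fix i j k
  assume "coeff3 (F * G) i j k \<noteq> 0"
  then have "(\<Sum>c\<le>k. \<Sum>b\<le>j. \<Sum>a\<le>i. coeff3 F a b c * coeff3 G (i - a) (j - b) (k - c)) \<noteq> 0"
    by (simp add: coeff_mult coeff_sum)
  then obtain c where c: "c \<le> k"
      "(\<Sum>b\<le>j. \<Sum>a\<le>i. coeff3 F a b c * coeff3 G (i - a) (j - b) (k - c)) \<noteq> 0"
    by (meson atMost_iff sum.not_neutral_contains_not_neutral)
  then obtain b where b: "b \<le> j" "(\<Sum>a\<le>i. coeff3 F a b c * coeff3 G (i - a) (j - b) (k - c)) \<noteq> 0"
    by (meson atMost_iff sum.not_neutral_contains_not_neutral)
  then obtain a where a: "a \<le> i" "coeff3 F a b c * coeff3 G (i - a) (j - b) (k - c) \<noteq> 0"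
    by (meson atMost_iff sum.not_neutral_contains_not_neutral)
  then have "coeff3 F a b c \<noteq> 0" "coeff3 G (i - a) (j - b) (k - c) \<noteq> 0"
    by auto
  then have "a + b + c = m" "(i - a) + (j - b) + (k - c) = n"
    using formsD[OF assms(1), of c b a] formsD[OF assms(2), of "k - c" "j - b" "i - a"] by auto
  then show "i + j + k = m + n"
    using a b c by linarith
qed

lemma forms_power: "F \<in> forms n \<Longrightarrow> F ^ k \<in> forms (k * n)"
  by (induction k) (auto simp: one_in_forms intro: forms_mult)

section \<open>Monomials of a given degree and homogeneous parts\<close>

definition degree_triples :: "nat \<Rightarrow> (nat \<times> nat \<times> nat) set" where
  "degree_triples n = {(i, j, k). i + j + k = n}"

lemma degree_triples_eq: "degree_triples n = (\<lambda>(k, j). (n - k - j, j, k)) ` (SIGMA k:{..n}. {..n - k})"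
  by (force simp: degree_triples_def image_def)

lemma finite_degree_triples [simp]: "finite (degree_triples n)"
  by (simp add: degree_triples_eq)

lemma card_degree_triples: "2 * card (degree_triples n) = (n + 1) * (n + 2)"
proof -
  have "card (degree_triples n) = card (SIGMA k:{..n}. {..n - k})"
    unfolding degree_triples_eq by (rule card_image) (auto simp: inj_on_def)
  also have "\<dots> = (\<Sum>k\<le>n. Suc (n - k))"
    by (subst card_SigmaI) auto
  also have "\<dots> = (\<Sum>k\<le>n. Suc k)"
    by (rule sum.reindex_bij_witness[of _ "\<lambda>k. n - k" "\<lambda>k. n - k"]) auto
  finally have "card (degree_triples n) = (\<Sum>k\<le>n. Suc k)" .
  moreover have "2 * (\<Sum>k\<le>n. Suc k) = (n + 1) * (n + 2)"
    by (induction n) auto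
  ultimately show ?thesis by simp
qed

definition hom_part :: "nat \<Rightarrow> 'a::comm_ring_1 poly3 \<Rightarrow> 'a poly3" where
  "hom_part n F = (\<Sum>(i, j, k)\<in>degree_triples n. monom3 (coeff3 F i j k) i j k)"

lemma coeff_hom_part: "coeff3 (hom_part n F) i j k = (if i + j + k = n then coeff3 F i j k else 0)"
proof -
  have "coeff3 (hom_part n F) i j k =
      (\<Sum>(i', j', k')\<in>degree_triples n. coeff3 (monom3 (coeff3 F i' j' k') i' j' k') i j k)"
    by (simp add: hom_part_def coeff_sum case_prod_unfold)
  also have "\<dots> = (\<Sum>t\<in>degree_triples n. if t = (i, j, k) then coeff3 F i j k else 0)"
    by (intro sum.cong) (auto simp: coeff_monom3 split: if_splits)
  also have "\<dots> = (if i + j + k = n then coeff3 F i j k else 0)"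
    by (subst sum.delta[OF finite_degree_triples]) (auto simp: degree_triples_def)
  finally show ?thesis .
qed

lemma hom_part_in_forms: "hom_part n F \<in> forms n"
  by (simp add: forms_def coeff_hom_part)

lemma hom_part_form: "F \<in> forms m \<Longrightarrow> hom_part n F = (if n = m then F else 0)"
  by (intro poly3_eqI) (auto simp: coeff_hom_part dest: formsD)

lemma forms_induct [consumes 1, case_names zero add monom]:
  assumes "F \<in> forms n"
    and "P 0" and "\<And>F G. P F \<Longrightarrow> P G \<Longrightarrow> P (F + G)"
    and "\<And>c i j k. i + j + k = n \<Longrightarrow> P (monom3 c i j k)"
  shows "P F"
proof -
  have sum: "P (\<Sum>t\<in>A. case t of (i, j, k) \<Rightarrow> monom3 (coeff3 F i j k) i j k)"
    if "finite A" "A \<subseteq> degree_triples n" for A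
    using that
    by (induction A rule: finite_induct) (auto intro!: assms(2-4) simp: degree_triples_def)
  have "F = hom_part n F"
    using assms(1) by (simp add: hom_part_form)
  then show ?thesis
    using sum[of "degree_triples n"] by (simp add: hom_part_def)
qed

lemma hom_part_sum: "hom_part n (sum f A) = (\<Sum>a\<in>A. hom_part n (f a))"
  by (rule poly3_eqI) (simp add: coeff_hom_part coeff_sum)

lemma sum_hom_parts: "\<exists>N. F = (\<Sum>n\<le>N. hom_part n F)"
proof -
  \<comment> \<open>A crude bound for the total degree of every monomial of \<open>F\<close>: on
    each of the two inner levels the degrees of all coefficients are added up.\<close>
  define N where "N = degree F + (\<Sum>k\<le>degree F. degree (coeff F k)) +
      (\<Sum>k\<le>degree F. \<Sum>j\<le>degree (coeff F k). degree (coeff (coeff F k) j))"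
  have "i + j + k \<le> N" if "coeff3 F i j k \<noteq> 0" for i j k
  proof -
    have k: "k \<le> degree F" and j: "j \<le> degree (coeff F k)" and i: "i \<le> degree (coeff (coeff F k) j)"
      using that by (auto intro!: le_degree)
    have "degree (coeff F k) \<le> (\<Sum>k\<le>degree F. degree (coeff F k))"
      using k by (intro member_le_sum) auto
    moreover have "degree (coeff (coeff F k) j) \<le> (\<Sum>j\<le>degree (coeff F k). degree (coeff (coeff F k) j))"
      using j by (intro member_le_sum) auto
    moreover have "\<dots> \<le> (\<Sum>k\<le>degree F. \<Sum>j\<le>degree (coeff F k). degree (coeff (coeff F k) j))"
      using k by (intro member_le_sum) auto
    ultimately show ?thesis
      using i j k unfolding N_def by linarith
  qed
  then have "F = (\<Sum>n\<le>N. hom_part n F)"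
    by (intro poly3_eqI) (auto simp: coeff_sum coeff_hom_part)
  then show ?thesis ..
qed

text \<open>The part of \<open>F * G\<close> in degree \<open>m + e\<close> is \<open>F\<close>
  times the part of \<open>G\<close> in degree \<open>e\<close>. As \<open>F * G\<close> has only a
  part in degree \<open>n\<close>, only the part of \<open>G\<close> in degree \<open>n - m\<close>
  survives cancelling \<open>F\<close>.\<close>

lemma form_cofactor:
  fixes F :: "'a::field poly3"
  assumes "F \<in> forms m" "F \<noteq> 0" "F * G \<in> forms n" "F * G \<noteq> 0"
  shows "m \<le> n \<and> G \<in> forms (n - m)"
proof -
  obtain N where N: "G = (\<Sum>e\<le>N. hom_part e G)"
    using sum_hom_parts by blast
  have parts: "hom_part e' (F * G) = (if m \<le> e' \<and> e' \<le> N + m then F * hom_part (e' - m) G else 0)" for e'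
  proof -
    have "hom_part e' (F * G) = (\<Sum>e\<le>N. hom_part e' (F * hom_part e G))"
      by (subst N) (simp add: sum_distrib_left hom_part_sum)
    also have "\<dots> = (\<Sum>e\<le>N. if e' = m + e then F * hom_part e G else 0)"
      by (intro sum.cong refl hom_part_form forms_mult assms hom_part_in_forms)
    also have "\<dots> = (\<Sum>e\<le>N. if e = e' - m then (if m \<le> e' then F * hom_part e G else 0) else 0)"
      by (intro sum.cong) auto
    also have "\<dots> = (if m \<le> e' \<and> e' \<le> N + m then F * hom_part (e' - m) G else 0)"
      by auto
    finally show ?thesis .
  qed
  have "hom_part n (F * G) \<noteq> 0"
    using assms(3,4) by (simp add: hom_part_form)
  then have "m \<le> n"
    unfolding parts by (auto split: if_splits)
  moreover have "hom_part e G = 0" if "e \<le> N" "e \<noteq> n - m" for e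
  proof -
    have "hom_part (m + e) (F * G) = 0"
      using that \<open>m \<le> n\<close> assms(3) by (subst hom_part_form[OF assms(3)]) auto
    then show ?thesis
      using that assms(2) unfolding parts by auto
  qed
  then have "G = (\<Sum>e\<le>N. if e = n - m then hom_part e G else 0)"
    by (subst N, intro sum.cong) auto
  then have "G = (if n - m \<le> N then hom_part (n - m) G else 0)"
    by simp
  then have "G \<in> forms (n - m)"
    by (metis hom_part_in_forms forms_0)
  ultimately show ?thesis by simp
qed

section \<open>The dimension of the space of forms\<close>

lemma forms_span:
  "(forms n :: 'a::field poly3 set) \<subseteq> forms3.span ((\<lambda>(i, j, k). monom3 1 i j k) ` degree_triples n)"
proof
  fix F :: "'a poly3"
  assume "F \<in> forms n"
  then show "F \<in> forms3.span ((\<lambda>(i, j, k). monom3 1 i j k) ` degree_triples n)"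
  proof (induction rule: forms_induct)
    case (monom c i j k)
    have "scale3 c (monom3 1 i j k) \<in> forms3.span ((\<lambda>(i, j, k). monom3 1 i j k) ` degree_triples n)"
      using monom by (intro forms3.span_scale forms3.span_base) (force simp: degree_triples_def)
    then show ?case
      by (simp add: scale3_monom3_1)
  qed (auto intro: forms3.span_add forms3.span_zero)
qed

lemma dim_forms: "forms3.dim (forms n :: 'a::field poly3 set) = card (degree_triples n)"
proof (rule forms3.dim_unique[OF _ forms_span])
  let ?m = "\<lambda>(i, j, k). monom3 (1::'a) i j k"
  show "?m ` degree_triples n \<subseteq> forms n"
    by (auto simp: degree_triples_def intro: monom3_in_forms)
  have inj: "inj_on ?m (degree_triples n)"
  proof (rule inj_onI)
    fix s t
    assume eq: "?m s = ?m t"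
    obtain i j k i' j' k' where [simp]: "s = (i, j, k)" "t = (i', j', k')"
      by (metis prod_cases3)
    have "coeff3 (?m s) i' j' k' = 1"
      unfolding eq by (simp add: coeff_monom3)
    then show "s = t"
      by (auto simp: coeff_monom3 split: if_splits)
  qed
  then show "card (?m ` degree_triples n) = card (degree_triples n)"
    by (rule card_image)
  show "forms3.independent (?m ` degree_triples n)"
  proof (rule forms3.independent_if_scalars_zero)
    fix f :: "'a poly3 \<Rightarrow> 'a" and x
    assume sum: "(\<Sum>x\<in>?m ` degree_triples n. scale3 (f x) x) = 0" and "x \<in> ?m ` degree_triples n"
    then obtain i j k where x: "(i, j, k) \<in> degree_triples n" "x = monom3 1 i j k"
      by auto
    have "0 = coeff3 (\<Sum>x\<in>?m ` degree_triples n. scale3 (f x) x) i j k"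
      by (simp add: sum)
    also have "\<dots> = (\<Sum>t\<in>degree_triples n. coeff3 (scale3 (f (?m t)) (?m t)) i j k)"
      by (subst sum.reindex[OF inj]) (simp add: coeff_sum)
    also have "\<dots> = (\<Sum>t\<in>degree_triples n. if t = (i, j, k) then f x else 0)"
      by (intro sum.cong) (auto simp: coeff_scale3 coeff_monom3 x split: if_splits)
    also have "\<dots> = f x"
      using x by simp
    finally show "f x = 0" by simp
  qed auto
qed

subsection \<open>Substituting polynomials into forms\<close>

lemma poly_map_poly_add:
  assumes "h 0 = 0" "\<And>a b. h (a + b) = h a + h b"
  shows "poly (map_poly h (p + q)) z = poly (map_poly h p) z + poly (map_poly h q) z"
  by (induction p q rule: poly_induct2) (auto simp: assms Polynomial.map_poly_pCons algebra_simps)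

text \<open>Together with additivity this makes applying \<open>h\<close> to the coefficients and
  then evaluating a ring homomorphism; it is needed once for each of the two outer
  variables.\<close>

lemma poly_map_poly_mult:
  assumes "h 0 = 0" "\<And>a b. h (a + b) = h a + h b" "\<And>a b. h (a * b) = h a * h b"
  shows "poly (map_poly h (p * q)) z = poly (map_poly h p) z * poly (map_poly h q) z"
proof (induction p)
  case (pCons a p)
  have "poly (map_poly h (smult a q)) z = h a * poly (map_poly h q) z"
    by (induction q) (simp_all add: assms Polynomial.map_poly_pCons algebra_simps)
  moreover have "poly (map_poly h (pCons a p * q)) z =
      poly (map_poly h (smult a q)) z + poly (map_poly h (pCons 0 (p * q))) z"
    unfolding mult_pCons_left by (rule poly_map_poly_add) (fact assms)+
  moreover have "map_poly h (pCons 0 (p * q)) = pCons 0 (map_poly h (p * q))"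
    "map_poly h (pCons a p) = pCons (h a) (map_poly h p)"
    using Polynomial.map_poly_pCons[of h, OF assms(1)] by (simp_all only: assms(1))
  ultimately show ?case
    by (simp only: pCons.IH poly_pCons distrib_right mult.assoc add_0_left)
qed simp

text \<open>The ring homomorphism from $k[X,Y,Z]$ to $k[t]$ that sends the variables to the
  components of \<open>v\<close>. Only the innermost variable has coefficients in the field, so it
  alone is replaced by composition.\<close>

definition subst3 :: "'a::comm_ring_1 poly \<times> 'a poly \<times> 'a poly \<Rightarrow> 'a poly3 \<Rightarrow> 'a poly" where
  "subst3 v F = poly (map_poly (\<lambda>q. poly (map_poly (\<lambda>p. pcompose p (fst v)) q) (fst (snd v))) F) (snd (snd v))"

lemma subst3_0 [simp]: "subst3 v 0 = 0"
  by (simp add: subst3_def)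

lemma subst3_add: "subst3 v (F + G) = subst3 v F + subst3 v G"
  and subst3_mult: "subst3 v (F * G) = subst3 v F * subst3 v G"
proof -
  define h1 where "h1 = (\<lambda>p. pcompose p (fst v))"
  define h2 where "h2 = (\<lambda>q. poly (map_poly h1 q) (fst (snd v)))"
  have h1: "h1 0 = 0" "h1 (p + q) = h1 p + h1 q" "h1 (p * q) = h1 p * h1 q" for p q
    by (simp_all add: h1_def pcompose_add pcompose_mult)
  have h2: "h2 0 = 0" "h2 (p + q) = h2 p + h2 q" "h2 (p * q) = h2 p * h2 q" for p q
    unfolding h2_def using poly_map_poly_add[of h1, OF h1(1,2)] poly_map_poly_mult[of h1, OF h1]
    by simp_all
  have "subst3 v F = poly (map_poly h2 F) (snd (snd v))" for F
    by (simp only: subst3_def h2_def h1_def)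
  then show "subst3 v (F + G) = subst3 v F + subst3 v G" "subst3 v (F * G) = subst3 v F * subst3 v G"
    using poly_map_poly_add[of h2, OF h2(1,2)] poly_map_poly_mult[of h2, OF h2] by simp_all
qed

lemma subst3_const3: "subst3 v (const3 c) = [:c:]"
  by (cases "c = 0") (simp_all add: subst3_def const3_def Polynomial.map_poly_pCons pcompose_pCons)

lemma subst3_1 [simp]: "subst3 v 1 = 1"
  using subst3_const3[of v 1] by (simp add: const3_1 one_pCons[symmetric])

lemma subst3_scale: "subst3 v (scale3 c F) = smult c (subst3 v F)"
  by (simp add: scale3_def subst3_mult subst3_const3)

lemma subst3_sum: "subst3 v (sum f A) = (\<Sum>a\<in>A. subst3 v (f a))"
  by (induction A rule: infinite_finite_induct) (auto simp: subst3_add)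

lemma subst3_power: "subst3 v (F ^ n) = subst3 v F ^ n"
  by (induction n) (auto simp: subst3_mult)

lemma subst3_diff: "subst3 v (F - G) = subst3 v F - subst3 v G"
  using subst3_add[of v "F - G" G] by simp

lemma subst3_monom3: "subst3 (x, y, z) (monom3 c i j k) = smult c (x ^ i * y ^ j * z ^ k)"
proof -
  have "pcompose (monom c i) x = smult c (x ^ i)"
    by (induction i) (simp_all add: monom_Suc monom_0)
  then have "subst3 (x, y, z) (monom3 c i j k) = smult c (x ^ i) * y ^ j * z ^ k"
    by (simp only: subst3_def monom3_def map_poly_monom poly_monom fst_conv snd_conv pcompose_0 poly_0 map_poly_0)
  then show ?thesis by simp
qed

lemma poly_subst3:
  "poly (subst3 (x, y, z) F) t = eval3 F (poly x t, poly y t, poly z t)"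
proof -
  have 1: "poly (poly (map_poly (\<lambda>p. pcompose p x) q) y) t = poly (poly q [:poly y t:]) (poly x t)" for q
    by (induction q) (simp_all add: Polynomial.map_poly_pCons poly_pcompose)
  show ?thesis
    unfolding subst3_def eval3.simps
    by (induction F) (simp_all add: Polynomial.map_poly_pCons 1)
qed

section \<open>Values of forms at coordinate triples\<close>

lemma eval3_add: "eval3 (F + G) v = eval3 F v + eval3 G v"
  and eval3_mult: "eval3 (F * G) v = eval3 F v * eval3 G v"
  and eval3_scale: "eval3 (scale3 c F) v = c * eval3 F v"
  and eval3_0 [simp]: "eval3 0 v = 0"
  and eval3_1 [simp]: "eval3 1 v = 1"
  by (cases v; simp add: scale3_def const3_def)+

lemma eval3_power: "eval3 (F ^ n) v = eval3 F v ^ n"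
  by (induction n) (auto simp: eval3_mult)

lemma eval3_monom3: "eval3 (monom3 c i j k) (x, y, z) = c * (x ^ i * y ^ j * z ^ k)"
proof -
  have const_power: "[:a:] ^ n = [:a ^ n:]" for a :: "'b::comm_ring_1" and n
    by (induction n) simp_all
  have "poly (poly (monom (monom p j) k) [:[:z:]:]) [:y:] = p * [:y ^ j * z ^ k:]" for p
    by (simp add: poly_monom const_power)
  then show ?thesis
    by (simp add: monom3_def poly_monom)
qed

text \<open>A univariate polynomial over a domain with infinitely many roots is zero. This is
  applied to the three variables in turn, with the field embedded as constants into the coefficient
  rings.\<close>

lemma poly3_eq_0:
  fixes F :: "'a::field_char_0 poly3"
  assumes "\<And>v. eval3 F v = 0"
  shows "F = 0"
proof -
  have *: "p = 0" if "\<And>c. poly p (h c) = 0" "inj h" for p :: "'b::idom poly" and h :: "'a \<Rightarrow> 'b"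
  proof (rule ccontr)
    assume "p \<noteq> 0"
    then have "finite {x. poly p x = 0}"
      by (rule poly_roots_finite)
    moreover have "range h \<subseteq> {x. poly p x = 0}"
      using that by auto
    moreover have "infinite (range h)"
      using that(2) infinite_UNIV_char_0 finite_imageD by blast
    ultimately show False
      by (meson finite_subset)
  qed
  have "poly (poly F [:[:z:]:]) [:y:] = 0" for y z
    by (rule *[of _ "\<lambda>x. x"]) (use assms[of "(_, y, z)"] in \<open>auto simp: inj_def\<close>)
  then have "poly F [:[:z:]:] = 0" for z
    by (rule *) (auto simp: inj_def)
  then show ?thesis
    by (rule *) (auto simp: inj_def)
qed

fun mult_triple :: "'a::times \<Rightarrow> 'a \<times> 'a \<times> 'a \<Rightarrow> 'a \<times> 'a \<times> 'a" where
  "mult_triple c (x, y, z) = (c * x, c * y, c * z)"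

lemma eval3_mult_triple:
  assumes "F \<in> forms n"
  shows "eval3 F (mult_triple c v) = c ^ n * eval3 F v"
proof (cases v)
  case (fields x y z)
  from assms have "eval3 F (c * x, c * y, c * z) = c ^ n * eval3 F (x, y, z)"
  proof (induction rule: forms_induct)
    case (monom a i j k)
    then show ?case
      by (auto simp: eval3_monom3 power_mult_distrib power_add simp del: eval3.simps)
  qed (auto simp: eval3_add distrib_left simp del: eval3.simps)
  then show ?thesis
    by (simp add: fields del: eval3.simps)
qed

lemma form_eval3_zero:
  assumes "F \<in> forms n" "n > 0"
  shows "eval3 F (0, 0, 0) = 0"
proof -
  have "eval3 F (0, 0, 0) = 0 ^ n * eval3 F (0, 0, 0)"
    using eval3_mult_triple[OF assms(1), of 0 "(0, 0, 0)"] by (simp del: eval3.simps)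
  then show ?thesis
    using zero_power[OF assms(2), where 'a = 'a] by (metis mult_zero_left)
qed

section \<open>Degrees and top coefficients after substitution\<close>

lemma degree_mult_le_sum:
  fixes p q :: "'a::comm_ring_1 poly"
  assumes "degree p \<le> m" "degree q \<le> n"
  shows "degree (p * q) \<le> m + n \<and> coeff (p * q) (m + n) = coeff p m * coeff q n"
proof
  show "degree (p * q) \<le> m + n"
    using degree_mult_le[of p q] assms by linarith
  have "coeff (p * q) (m + n) = (\<Sum>i\<le>m + n. coeff p i * coeff q (m + n - i))"
    by (rule coeff_mult)
  also have "\<dots> = (\<Sum>i\<in>{m}. coeff p i * coeff q (m + n - i))"
  proof (rule sum.mono_neutral_right)
    show "\<forall>i\<in>{..m + n} - {m}. coeff p i * coeff q (m + n - i) = 0"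
    proof
      fix i assume "i \<in> {..m + n} - {m}"
      then consider "i > m" | "m + n - i > n" by fastforce
      then show "coeff p i * coeff q (m + n - i) = 0"
        by cases (use assms in \<open>auto simp: coeff_eq_0\<close>)
    qed
  qed auto
  finally show "coeff (p * q) (m + n) = coeff p m * coeff q n" by simp
qed

lemma degree_power_le_mult:
  fixes p :: "'a::comm_ring_1 poly"
  assumes "degree p \<le> m"
  shows "degree (p ^ n) \<le> n * m \<and> coeff (p ^ n) (n * m) = coeff p m ^ n"
proof (induction n)
  case (Suc n)
  then show ?case
    using degree_mult_le_sum[of p m "p ^ n" "n * m"] assms by simp
qed simp

text \<open>\<open>D\<close> is a common bound for the degrees, so the coefficients at
  \<open>D\<close> are the coordinates of the limit of the parametrization at infinity; the value of
  a form there appears as the coefficient at \<open>n * D\<close>.\<close>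

lemma degree_subst3_le:
  assumes "F \<in> forms n" "degree x \<le> D" "degree y \<le> D" "degree z \<le> D"
  shows "degree (subst3 (x, y, z) F) \<le> n * D \<and>
    coeff (subst3 (x, y, z) F) (n * D) = eval3 F (coeff x D, coeff y D, coeff z D)"
  using assms(1)
proof (induction rule: forms_induct)
  case (add F G)
  then show ?case
    by (auto simp: subst3_add eval3_add degree_add_le simp del: eval3.simps)
next
  case (monom c i j k)
  have "degree (x ^ i * y ^ j * z ^ k) \<le> (i * D + j * D) + k * D \<and>
      coeff (x ^ i * y ^ j * z ^ k) ((i * D + j * D) + k * D) = coeff x D ^ i * coeff y D ^ j * coeff z D ^ k"
    using degree_power_le_mult[OF assms(2), of i] degree_power_le_mult[OF assms(3), of j]
      degree_power_le_mult[OF assms(4), of k] degree_mult_le_sum[of "x ^ i" "i * D" "y ^ j" "j * D"]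
      degree_mult_le_sum[of "x ^ i * y ^ j" "i * D + j * D" "z ^ k" "k * D"] by simp
  moreover have "n * D = (i * D + j * D) + k * D"
    by (simp add: monom[symmetric] algebra_simps)
  ultimately show ?case
    using degree_smult_le[of c "x ^ i * y ^ j * z ^ k"]
    by (auto simp: subst3_monom3 eval3_monom3 simp del: eval3.simps)
qed auto

section \<open>Lines\<close>

definition linear_form :: "'a::field \<Rightarrow> 'a \<Rightarrow> 'a \<Rightarrow> 'a poly3" where
  "linear_form a b c = monom3 a 1 0 0 + monom3 b 0 1 0 + monom3 c 0 0 1"

lemma linear_form_in_forms: "linear_form a b c \<in> forms 1"
  unfolding linear_form_def by (intro forms_add monom3_in_forms) auto

lemma eval3_linear_form: "eval3 (linear_form a b c) (x, y, z) = a * x + b * y + c * z"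
  by (simp add: linear_form_def eval3_add eval3_monom3 del: eval3.simps)

text \<open>If the coordinate \<open>r\<close> of \<open>R\<close> is nonzero, then proportionality
  to \<open>R\<close> amounts to two linear equations, each comparing the coordinate at that place
  with one of the other two.\<close>

lemma two_lines_through_point:
  fixes R :: "'a::field \<times> 'a \<times> 'a"
  assumes "R \<noteq> (0, 0, 0)"
  obtains A B where "A \<in> forms 1" "B \<in> forms 1"
    "\<And>v. eval3 A v = 0 \<Longrightarrow> eval3 B v = 0 \<Longrightarrow> \<exists>c. v = mult_triple c R"
proof -
  obtain r1 r2 r3 where R: "R = (r1, r2, r3)" by (cases R)
  have quot: "b = a / r * s" if "r \<noteq> 0" "s * a = r * b" for a b r s :: 'a
    using that by (simp add: field_simps)
  consider "r1 \<noteq> 0" | "r2 \<noteq> 0" | "r3 \<noteq> 0" using assms R by auto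
  then show thesis
  proof cases
    case 1
    have "v = mult_triple (fst v / r1) R"
      if "eval3 (linear_form r2 (- r1) 0) v = 0" "eval3 (linear_form r3 0 (- r1)) v = 0" for v
      using that quot[OF 1, of r2 "fst v" "fst (snd v)"] quot[OF 1, of r3 "fst v" "snd (snd v)"] 1
      by (cases v) (simp add: R eval3_linear_form del: eval3.simps)
    then show thesis
      by (intro that[OF linear_form_in_forms linear_form_in_forms]) blast
  next
    case 2
    have "v = mult_triple (fst (snd v) / r2) R"
      if "eval3 (linear_form (- r2) r1 0) v = 0" "eval3 (linear_form 0 r3 (- r2)) v = 0" for v
      using that quot[OF 2, of r1 "fst (snd v)" "fst v"] quot[OF 2, of r3 "fst (snd v)" "snd (snd v)"] 2
      by (cases v) (simp add: R eval3_linear_form del: eval3.simps)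
    then show thesis
      by (intro that[OF linear_form_in_forms linear_form_in_forms]) blast
  next
    case 3
    have "v = mult_triple (snd (snd v) / r3) R"
      if "eval3 (linear_form (- r3) 0 r1) v = 0" "eval3 (linear_form 0 (- r3) r2) v = 0" for v
      using that quot[OF 3, of r1 "snd (snd v)" "fst v"] quot[OF 3, of r2 "snd (snd v)" "fst (snd v)"] 3
      by (cases v) (simp add: R eval3_linear_form del: eval3.simps)
    then show thesis
      by (intro that[OF linear_form_in_forms linear_form_in_forms]) blast
  qed
qed

text \<open>An element of least degree generates the ideal. A common root is excluded, so over an
  algebraically closed field the generator is a nonzero constant.\<close>

lemma ideal_without_root:
  fixes I :: "'a::alg_closed_field poly set"
  assumes "\<And>p q. p \<in> I \<Longrightarrow> q \<in> I \<Longrightarrow> p + q \<in> I" "\<And>p q. p \<in> I \<Longrightarrow> q * p \<in> I"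
    and "\<And>t. \<exists>p\<in>I. poly p t \<noteq> 0"
  shows "1 \<in> I"
proof -
  obtain p0 where "p0 \<in> I" "p0 \<noteq> 0"
    using assms(3)[of 0] by force
  then obtain p where p: "p \<in> I" "p \<noteq> 0" "\<And>q. q \<in> I \<Longrightarrow> q \<noteq> 0 \<Longrightarrow> degree p \<le> degree q"
    using ex_has_least_nat[of "\<lambda>p. p \<in> I \<and> p \<noteq> 0" p0 degree] by blast
  have dvd: "p dvd q" if "q \<in> I" for q
  proof -
    define r where "r = q mod p"
    have "r = q + (- (q div p)) * p"
      using minus_div_mult_eq_mod[of q p] by (simp add: r_def)
    then have "r \<in> I"
      using assms(1)[OF that assms(2)[OF p(1), of "- (q div p)"]] by simp
    moreover have "r = 0 \<or> degree r < degree p"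
      unfolding r_def using p(2) by (rule degree_mod_less)
    ultimately have "r = 0"
      using p(3)[of r] by force
    then show ?thesis by (simp add: r_def mod_eq_0_iff_dvd)
  qed
  have "degree p = 0"
  proof (rule ccontr)
    assume "degree p \<noteq> 0"
    then obtain t where "poly p t = 0"
      using alg_closed_imp_poly_has_root[of p] by auto
    then show False
      using assms(3)[of t] dvd by (metis dvdE mult_zero_left poly_mult)
  qed
  then obtain c where c: "p = [:c:]"
    by (rule degree_eq_zeroE)
  then have "[:1 / c:] * p = 1"
    using p(2) by simp
  then show ?thesis
    using assms(2)[OF p(1), of "[:1 / c:]"] by simp
qed

subsection \<open>Curves parametrized by the affine line\<close>

fun triple_at :: "'a::comm_ring_1 poly \<times> 'a poly \<times> 'a poly \<Rightarrow> 'a \<Rightarrow> 'a \<times> 'a \<times> 'a" where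
  "triple_at (x, y, z) t = (poly x t, poly y t, poly z t)"

lemma poly_subst3_triple: "poly (subst3 v F) t = eval3 F (triple_at v t)"
  by (cases v) (simp only: poly_subst3 triple_at.simps)

lemma poly_eqI_values:
  fixes p q :: "'a::field_char_0 poly"
  assumes "\<And>t. poly p t = poly q t"
  shows "p = q"
  using assms by (simp add: poly_eq_poly_eq_iff[symmetric] fun_eq_iff)

lemma mult_triple_mult: "mult_triple a (mult_triple b v) = mult_triple (a * b) (v :: 'a::comm_ring_1 \<times> 'a \<times> 'a)"
  by (cases v) (simp add: mult.assoc)

lemma mult_triple_1 [simp]: "mult_triple 1 v = (v :: 'a::comm_ring_1 \<times> 'a \<times> 'a)"
  by (cases v) simp

lemma mult_triple_0: "mult_triple 0 v = (0, 0, 0 :: 'a::comm_ring_1)"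
  by (cases v) simp

text \<open>The last assumption says that the parameter \<open>t\<close> is a regular function on the curve without \<open>P\<close>.\<close>

locale parametrized_curve =
  fixes F :: "'a::{alg_closed_field, field_char_0} poly3" and d :: nat
    and \<phi> :: "'a poly \<times> 'a poly \<times> 'a poly" and P :: "'a \<times> 'a \<times> 'a"
  assumes F_form: "F \<in> forms d"
    and F_irreducible: "irreducible F"
    and \<phi>_nonzero: "triple_at \<phi> t \<noteq> (0, 0, 0)"
    and F_\<phi>: "eval3 F (triple_at \<phi> t) = 0"
    and P_nonzero: "P \<noteq> (0, 0, 0)"
    and F_P: "eval3 F P = 0"
    and curve_points: "v \<noteq> (0, 0, 0) \<Longrightarrow> eval3 F v = 0 \<Longrightarrow>
      (\<exists>c. v = mult_triple c P) \<or> (\<exists>c t. v = mult_triple c (triple_at \<phi> t))"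
    and parameter_regular: "\<exists>m G H. G \<in> forms m \<and> H \<in> forms m \<and> eval3 H (triple_at \<phi> t) \<noteq> 0 \<and>
      [:0, 1:] * subst3 \<phi> H = subst3 \<phi> G"
begin

abbreviation \<rho> :: "'a poly3 \<Rightarrow> 'a poly" where "\<rho> \<equiv> subst3 \<phi>"

definition W :: "nat \<Rightarrow> 'a poly set" where "W n = \<rho> ` forms n"

text \<open>The degree of the parametrization; \<open>D_eq_d\<close> identifies it with the degree
  of the curve.\<close>

definition D :: nat where
  "D = max (degree (fst \<phi>)) (max (degree (fst (snd \<phi>))) (degree (snd (snd \<phi>))))"

text \<open>Coordinates of the point at infinity of the parametrization; \<open>lead_eq_P\<close>
  shows that it is the distinguished point.\<close>

definition lead :: "'a \<times> 'a \<times> 'a" where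
  "lead = (coeff (fst \<phi>) D, coeff (fst (snd \<phi>)) D, coeff (snd (snd \<phi>)) D)"

lemma F_nonzero: "F \<noteq> 0"
  using F_irreducible by auto

lemma prime_F: "prime_elem F"
  using F_irreducible by simp

lemma d_pos: "d > 0"
proof (rule ccontr)
  assume "\<not> d > 0"
  then have "F \<in> forms 0" using F_form by simp
  then have *: "F = const3 (coeff3 F 0 0 0)"
    by (intro poly3_eqI) (auto simp: const3_def coeff_pCons split: nat.splits dest: formsD)
  have "eval3 F P = coeff3 F 0 0 0"
    by (subst *) (cases P; simp add: const3_def)
  then show False
    using * F_P F_nonzero by (simp add: const3_def)
qed

section \<open>The point at infinity of the parametrization\<close>

lemma \<rho>_form:
  assumes "G \<in> forms n"
  shows "degree (\<rho> G) \<le> n * D" "coeff (\<rho> G) (n * D) = eval3 G lead"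
proof -
  obtain x y z where \<phi>: "\<phi> = (x, y, z)" by (cases \<phi>)
  show "degree (\<rho> G) \<le> n * D" "coeff (\<rho> G) (n * D) = eval3 G lead"
    using degree_subst3_le[OF assms, of x D y z] unfolding lead_def D_def
    by (simp_all add: \<phi> del: eval3.simps)
qed

lemma lead_nonzero: "lead \<noteq> (0, 0, 0)"
proof
  assume *: "lead = (0, 0, 0)"
  have "D = degree (fst \<phi>) \<or> D = degree (fst (snd \<phi>)) \<or> D = degree (snd (snd \<phi>))"
    by (auto simp: D_def max_def)
  with * have "fst \<phi> = 0 \<and> D = degree (fst \<phi>) \<or> fst (snd \<phi>) = 0 \<and> D = degree (fst (snd \<phi>)) \<or>
      snd (snd \<phi>) = 0 \<and> D = degree (snd (snd \<phi>))"
    by (auto simp: lead_def)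
  then have "D = 0" by auto
  then have "degree (fst \<phi>) = 0" "degree (fst (snd \<phi>)) = 0" "degree (snd (snd \<phi>)) = 0"
    by (auto simp: D_def)
  with * \<open>D = 0\<close> have "fst \<phi> = 0" "fst (snd \<phi>) = 0" "snd (snd \<phi>) = 0"
    unfolding lead_def by (metis fst_conv snd_conv leading_coeff_0_iff)+
  then have "triple_at \<phi> 0 = (0, 0, 0)"
    by (cases \<phi>) simp
  then show False
    using \<phi>_nonzero by blast
qed

lemma \<rho>_F [simp]: "\<rho> F = 0"
  by (rule poly_eqI_values) (simp add: poly_subst3_triple F_\<phi> del: eval3.simps)

text \<open>The parameter has a pole at infinity but is regular on the affine part. If
  \<open>lead\<close> were an affine point, then some \<open>H\<close> with
  \<open>t * \<rho> H = \<rho> G\<close> would not vanish there, so \<open>\<rho> H\<close> would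
  have full degree \<open>m * D\<close> and \<open>\<rho> G\<close> a degree above its
  bound.\<close>

lemma lead_not_on_affine_part: "lead \<noteq> mult_triple c (triple_at \<phi> t)"
proof
  assume *: "lead = mult_triple c (triple_at \<phi> t)"
  obtain m G H where GH: "G \<in> forms m" "H \<in> forms m" "eval3 H (triple_at \<phi> t) \<noteq> 0"
      "[:0, 1:] * \<rho> H = \<rho> G"
    using parameter_regular by blast
  have "c \<noteq> 0"
    using * lead_nonzero by (auto simp: mult_triple_0)
  then have "coeff (\<rho> H) (m * D) \<noteq> 0"
    unfolding \<rho>_form(2)[OF GH(2)] * eval3_mult_triple[OF GH(2)] using GH(3) by simp
  then have "coeff (\<rho> G) (Suc (m * D)) \<noteq> 0"
    unfolding GH(4)[symmetric] by simp
  then have "Suc (m * D) \<le> degree (\<rho> G)"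
    by (rule le_degree)
  then show False
    using \<rho>_form(1)[OF GH(1)] by simp
qed

text \<open>By continuity \<open>F\<close> vanishes at \<open>lead\<close>: its value there is a
  coefficient of \<open>\<rho> F = 0\<close>. Since \<open>lead\<close> is no affine point, only
  \<open>P\<close> remains.\<close>

lemma lead_eq_P: "\<exists>c. c \<noteq> 0 \<and> lead = mult_triple c P"
proof -
  have "eval3 F lead = 0"
    using \<rho>_form(2)[OF F_form] by simp
  then obtain c where "lead = mult_triple c P"
    using curve_points[OF lead_nonzero] lead_not_on_affine_part by blast
  moreover from this have "c \<noteq> 0"
    using lead_nonzero by (auto simp: mult_triple_0)
  ultimately show ?thesis by blast
qed

text \<open>\<open>P\<close> is proportional to \<open>lead\<close>, so values at \<open>P\<close>
  are coefficients at \<open>n * D\<close> up to a nonzero factor.\<close>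

lemma eval3_P_iff:
  assumes "G \<in> forms n"
  shows "eval3 G P = 0 \<longleftrightarrow> coeff (\<rho> G) (n * D) = 0"
proof -
  obtain c where c: "c \<noteq> 0" "lead = mult_triple c P"
    using lead_eq_P by blast
  show ?thesis
    unfolding \<rho>_form(2)[OF assms] c(2) eval3_mult_triple[OF assms] using c(1) by simp
qed

lemma degree_\<rho>:
  assumes "G \<in> forms n" "eval3 G P \<noteq> 0"
  shows "degree (\<rho> G) = n * D" "\<rho> G \<noteq> 0"
  using assms eval3_P_iff[OF assms(1)] \<rho>_form(1)[OF assms(1)] le_degree[of "\<rho> G" "n * D"]
  by (auto simp del: eval3.simps)

text \<open>A constant parametrization would make all restrictions constant, against
  \<open>t * \<rho> H = \<rho> G\<close>.\<close>

lemma D_pos: "D > 0"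
proof (rule ccontr)
  assume "\<not> D > 0"
  obtain m G H where GH: "G \<in> forms m" "H \<in> forms m" "eval3 H (triple_at \<phi> 0) \<noteq> 0"
      "[:0, 1:] * \<rho> H = \<rho> G"
    using parameter_regular by blast
  have "\<rho> H \<noteq> 0"
    using GH(3) poly_subst3_triple[of \<phi> H 0] by (auto simp del: eval3.simps)
  then have "degree (\<rho> G) = Suc (degree (\<rho> H))"
    unfolding GH(4)[symmetric] by (subst degree_mult_eq) auto
  then show False
    using \<rho>_form(1)[OF GH(1)] \<open>\<not> D > 0\<close> by simp
qed

section \<open>The restrictions of forms to the curve\<close>

lemma subspace_W: "polys.subspace (W n)"
proof (rule polys.subspaceI)
  show "0 \<in> W n"
    unfolding W_def using forms_0[of n] by (metis imageI subst3_0)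
next
  fix p q assume "p \<in> W n" "q \<in> W n"
  then obtain A B where "A \<in> forms n" "p = \<rho> A" "B \<in> forms n" "q = \<rho> B"
    unfolding W_def by blast
  then show "p + q \<in> W n"
    unfolding W_def by (intro image_eqI[of _ _ "A + B"] forms_add) (simp_all add: subst3_add)
next
  fix c p assume "p \<in> W n"
  then obtain A where "A \<in> forms n" "p = \<rho> A"
    unfolding W_def by blast
  then show "smult c p \<in> W n"
    unfolding W_def by (intro image_eqI[of _ _ "scale3 c A"] forms_scale) (simp_all add: subst3_scale)
qed

lemmas W_0 = polys.subspace_0[OF subspace_W]
  and W_add = polys.subspace_add[OF subspace_W]
  and W_scale = polys.subspace_scale[OF subspace_W]

lemma W_iff: "p \<in> W n \<longleftrightarrow> (\<exists>G\<in>forms n. p = \<rho> G)"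
  by (auto simp: W_def)

lemma W_mult:
  assumes "p \<in> W m" "q \<in> W n"
  shows "p * q \<in> W (m + n)"
proof -
  obtain A B where "A \<in> forms m" "p = \<rho> A" "B \<in> forms n" "q = \<rho> B"
    using assms unfolding W_iff by blast
  then show ?thesis
    unfolding W_iff using forms_mult[of A m B n] by (intro bexI[of _ "A * B"]) (simp_all add: subst3_mult)
qed

lemma W_power:
  assumes "p \<in> W n"
  shows "p ^ k \<in> W (k * n)"
proof -
  obtain A where "A \<in> forms n" "p = \<rho> A"
    using assms unfolding W_iff by blast
  then show ?thesis
    unfolding W_iff using forms_power[of A n k] by (intro bexI[of _ "A ^ k"]) (simp_all add: subst3_power)
qed

lemma degree_W: "p \<in> W n \<Longrightarrow> degree p \<le> n * D"
  unfolding W_def using \<rho>_form(1) by auto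

text \<open>Take two lines through a point off the curve.\<close>

lemma coprime_linear_forms:
  obtains A B where "A \<in> forms 1" "B \<in> forms 1" "eval3 B P \<noteq> 0"
    "\<And>t. eval3 A (triple_at \<phi> t) = 0 \<Longrightarrow> eval3 B (triple_at \<phi> t) \<noteq> 0"
proof -
  obtain R where R: "eval3 F R \<noteq> 0"
    using poly3_eq_0 F_nonzero by blast
  then have "R \<noteq> (0, 0, 0)"
    using form_eval3_zero[OF F_form d_pos] by metis
  then obtain A B where AB: "A \<in> forms 1" "B \<in> forms 1"
      "\<And>v. eval3 A v = 0 \<Longrightarrow> eval3 B v = 0 \<Longrightarrow> \<exists>c. v = mult_triple c R"
    by (rule two_lines_through_point) blast
  have no: "eval3 A v \<noteq> 0 \<or> eval3 B v \<noteq> 0" if v: "v \<noteq> (0, 0, 0)" "eval3 F v = 0" for v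
  proof (rule ccontr)
    assume "\<not> ?thesis"
    then obtain c where c: "v = mult_triple c R"
      using AB(3) by blast
    then have "c \<noteq> 0"
      using v(1) by (auto simp: mult_triple_0)
    then show False
      using v(2) R unfolding c eval3_mult_triple[OF F_form] by simp
  qed
  show thesis
  proof (cases "eval3 B P = 0")
    case True
    then show thesis
      using that[of B A] AB(1,2) no[OF P_nonzero F_P] no[OF \<phi>_nonzero F_\<phi>] by blast
  next
    case False
    then show thesis
      using that[of A B] AB(1,2) no[OF \<phi>_nonzero F_\<phi>] by blast
  qed
qed

text \<open>Each factor \<open>h\<close> can absorb one factor \<open>t\<close>, so
  \<open>h ^ r\<close> absorbs polynomials of degree up to \<open>r\<close>.\<close>

lemma powers_in_W:
  assumes "h \<in> W m" "[:0, 1:] * h \<in> W m" "degree q \<le> r"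
  shows "h ^ r * q \<in> W (r * m)"
  using assms(3)
proof (induction r arbitrary: q)
  case 0
  then obtain c where "q = [:c:]"
    by (metis degree_eq_zeroE le_zero_eq)
  then show ?case
    using W_scale[of 1 0 c] one_in_forms by (force simp: W_def)
next
  case (Suc r)
  obtain c q' where q: "q = pCons c q'"
    by (cases q)
  then have "degree q' \<le> r"
    using Suc.prems by (auto split: if_splits)
  then have "h ^ r * q' \<in> W (r * m)"
    by (rule Suc.IH)
  then have "([:0, 1:] * h) * (h ^ r * q') \<in> W (Suc r * m)"
    using W_mult[OF assms(2)] by simp
  moreover have "smult c (h ^ Suc r) \<in> W (Suc r * m)"
    by (intro W_scale W_power assms(1))
  ultimately have "smult c (h ^ Suc r) + ([:0, 1:] * h) * (h ^ r * q') \<in> W (Suc r * m)"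
    by (intro W_add)
  moreover have "smult c (h ^ Suc r) + ([:0, 1:] * h) * (h ^ r * q') = h ^ Suc r * q"
  proof -
    have "q = [:c:] + [:0, 1:] * q'"
      by (simp add: q)
    then have "h ^ Suc r * q = h ^ Suc r * [:c:] + [:0, 1:] * h * (h ^ r * q')"
      by (simp only: distrib_left power_Suc mult_ac)
    then show ?thesis by simp
  qed
  ultimately show ?case by simp
qed

text \<open>A graded version of the conductor of the coordinate ring of the curve in $k[t]$: the
  shift \<open>n\<close> may depend on \<open>w\<close> but not on the degree of the polynomial
  multiplied.\<close>

definition conductor :: "'a poly set" where
  "conductor = {w. \<exists>n. \<forall>j q. degree q \<le> j * D \<longrightarrow> w * q \<in> W (n + j)}"

text \<open>If linear forms restrict to coprime \<open>a\<close> and \<open>b\<close> with \<open>degree b = D\<close>, then every \<open>q\<close> can be written as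
  \<open>a * r + b * q1\<close> with \<open>degree r < D\<close>, which reduces the claim for \<open>q\<close> to lower degrees.\<close>

lemma power_in_conductor:
  assumes "h \<in> W m" "[:0, 1:] * h \<in> W m"
  shows "h ^ D \<in> conductor"
proof -
  obtain A B where AB: "A \<in> forms 1" "B \<in> forms 1" "eval3 B P \<noteq> 0"
    "\<And>t. eval3 A (triple_at \<phi> t) = 0 \<Longrightarrow> eval3 B (triple_at \<phi> t) \<noteq> 0"
    by (rule coprime_linear_forms) blast
  define a b where "a = \<rho> A" and "b = \<rho> B"
  have ab: "a \<in> W 1" "b \<in> W 1" "degree b = D" "degree a \<le> D" "b \<noteq> 0"
    using AB(1,2) degree_\<rho>[OF AB(2,3)] \<rho>_form(1)[OF AB(1)] by (auto simp: a_def b_def W_def)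
  \<comment> \<open>The two linear forms have no common zero on the affine part of the curve, so
    \<open>a\<close> and \<open>b\<close> generate the unit ideal.\<close>
  have "1 \<in> {u * a + v * b | u v. True}"
  proof (rule ideal_without_root)
    fix p q assume "p \<in> {u * a + v * b | u v. True}" "q \<in> {u * a + v * b | u v. True}"
    then obtain u v u' v' where "p = u * a + v * b" "q = u' * a + v' * b" by blast
    then have "p + q = (u + u') * a + (v + v') * b" by (simp add: algebra_simps)
    then show "p + q \<in> {u * a + v * b | u v. True}" by blast
  next
    fix p q assume "p \<in> {u * a + v * b | u v. True}"
    then obtain u v where "p = u * a + v * b" by blast
    then have "q * p = (q * u) * a + (q * v) * b" by (simp add: algebra_simps)
    then show "q * p \<in> {u * a + v * b | u v. True}" by blast
  next
    fix t
    have "a = 1 * a + 0 * b" "b = 0 * a + 1 * b" by simp_all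
    then have "a \<in> {u * a + v * b | u v. True}" "b \<in> {u * a + v * b | u v. True}" by blast+
    moreover have "poly a t \<noteq> 0 \<or> poly b t \<noteq> 0"
      using AB(4)[of t] by (auto simp: a_def b_def poly_subst3_triple simp del: eval3.simps)
    ultimately show "\<exists>p\<in>{u * a + v * b | u v. True}. poly p t \<noteq> 0" by blast
  qed
  then obtain u v where uv: "u * a + v * b = 1" by auto
  \<comment> \<open>The extra \<open>D - 1\<close> in the bound lets remainders modulo
    \<open>b\<close> satisfy the induction hypothesis for every \<open>j\<close>; for
    \<open>j = 0\<close> such a degree is absorbed by \<open>h ^ D\<close>.\<close>
  have "h ^ D * q \<in> W (D * m + j)" if "degree q \<le> j * D + (D - 1)" for j q
    using that
  proof (induction j arbitrary: q)
    case 0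
    then show ?case
      using powers_in_W[OF assms, of q D] by simp
  next
    case (Suc j)
    define s r where "s = (u * q) div b" and "r = (u * q) mod b"
    define q1 where "q1 = v * q + a * s"
    have "u * q = s * b + r"
      by (simp add: s_def r_def)
    then have "a * r + b * q1 = (u * a + v * b) * q"
      by (simp add: q1_def algebra_simps)
    then have q: "q = a * r + b * q1"
      by (simp add: uv)
    have r: "degree r \<le> D - 1"
      using degree_mod_less[OF ab(5), of "u * q"] ab(3) D_pos by (auto simp: r_def)
    have "degree (a * r) \<le> D + (D - 1)"
      using degree_mult_le[of a r] ab(4) r by linarith
    then have "degree (q - a * r) \<le> Suc j * D + (D - 1)"
      using Suc.prems by (intro degree_diff_le) auto
    then have "degree (b * q1) \<le> Suc j * D + (D - 1)"
      by (simp add: q)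
    then have "degree q1 \<le> j * D + (D - 1)"
      using ab(3,5) by (cases "q1 = 0") (auto simp: degree_mult_eq)
    then have "b * (h ^ D * q1) \<in> W (1 + (D * m + j))"
      by (intro W_mult ab Suc.IH)
    moreover have "a * (h ^ D * r) \<in> W (1 + (D * m + j))"
      using r by (intro W_mult ab Suc.IH) auto
    ultimately have "a * (h ^ D * r) + b * (h ^ D * q1) \<in> W (1 + (D * m + j))"
      by (intro W_add)
    then show ?case
      by (simp add: q algebra_simps)
  qed
  then show ?thesis
    unfolding conductor_def by (auto intro!: exI[of _ "D * m"])
qed

text \<open>The conductor is an ideal of $k[t]$. Regularity of the parameter supplies, for every
  \<open>t\<close>, an element of it that does not vanish at \<open>t\<close>, so it contains
  1.\<close>

lemma all_large_in_W:
  obtains N where "\<And>j q. degree q \<le> j * D \<Longrightarrow> q \<in> W (N + j)"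
proof -
  have "1 \<in> conductor"
  proof (rule ideal_without_root)
    fix w w' assume "w \<in> conductor" "w' \<in> conductor"
    then obtain n n' where n: "\<And>j q. degree q \<le> j * D \<Longrightarrow> w * q \<in> W (n + j)"
        "\<And>j q. degree q \<le> j * D \<Longrightarrow> w' * q \<in> W (n' + j)"
      unfolding conductor_def by blast
    have "(w + w') * q \<in> W (n + n' + j)" if "degree q \<le> j * D" for j q
    proof -
      have "degree q \<le> (n' + j) * D" "degree q \<le> (n + j) * D"
        using that by (simp_all add: add_mult_distrib)
      then have "w * q \<in> W (n + (n' + j))" "w' * q \<in> W (n' + (n + j))"
        using n by blast+
      then show ?thesis
        using W_add[of "w * q" "n + n' + j" "w' * q"] by (simp add: algebra_simps)
    qed
    then show "w + w' \<in> conductor"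
      unfolding conductor_def by blast
  next
    fix w w' assume "w \<in> conductor"
    then obtain n where n: "\<And>j q. degree q \<le> j * D \<Longrightarrow> w * q \<in> W (n + j)"
      unfolding conductor_def by blast
    \<comment> \<open>As \<open>D\<close> is at least 1, raising the degree of forms by
      \<open>degree w'\<close> makes enough room for the factor \<open>w'\<close>.\<close>
    have "w' * w * q \<in> W (n + degree w' + j)" if "degree q \<le> j * D" for j q
    proof -
      have "degree (w' * q) \<le> degree w' + j * D"
        using degree_mult_le[of w' q] that by simp
      also have "\<dots> \<le> (degree w' + j) * D"
        using D_pos by (simp add: add_mult_distrib)
      finally show ?thesis
        using n[of "w' * q" "degree w' + j"] by (simp add: mult_ac add_ac)
    qed
    then show "w' * w \<in> conductor"
      unfolding conductor_def by blast
  next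
    fix t
    obtain m G H where GH: "G \<in> forms m" "H \<in> forms m" "eval3 H (triple_at \<phi> t) \<noteq> 0"
        "[:0, 1:] * \<rho> H = \<rho> G"
      using parameter_regular by blast
    then have "\<rho> H ^ D \<in> conductor"
      by (intro power_in_conductor) (auto simp: W_def)
    moreover have "poly (\<rho> H ^ D) t \<noteq> 0"
      using GH(3) by (simp add: poly_subst3_triple del: eval3.simps)
    ultimately show "\<exists>p\<in>conductor. poly p t \<noteq> 0" by blast
  qed
  then obtain n where n: "\<And>j q. degree q \<le> j * D \<Longrightarrow> 1 * q \<in> W (n + j)"
    unfolding conductor_def by blast
  then show thesis
    using that[of n] by simp
qed

end

subsection \<open>The semigroup of orders of vanishing\<close>

lemma finite_forms_spanning: "finite ((\<lambda>(i, j, k). monom3 (1::'a::field) i j k) ` degree_triples n)"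
  by simp

lemma degree_le_span:
  "{p :: 'a::field poly. degree p \<le> n} \<subseteq> polys.span ((\<lambda>i. monom 1 i) ` {..n})"
proof
  fix p :: "'a poly"
  assume "p \<in> {p. degree p \<le> n}"
  then have "p = (\<Sum>i\<le>n. monom (coeff p i) i)"
    using poly_as_sum_of_monoms'[of p n] by simp
  also have "\<dots> = (\<Sum>i\<le>n. smult (coeff p i) (monom 1 i))"
    by (simp add: smult_monom)
  also have "\<dots> \<in> polys.span ((\<lambda>i. monom 1 i) ` {..n})"
    by (intro polys.span_sum polys.span_scale polys.span_base) auto
  finally show "p \<in> polys.span ((\<lambda>i. monom 1 i) ` {..n})" .
qed

lemma forms3_sum_scale_mult: "(\<Sum>b\<in>B. scale3 (c b) (F * g b)) = F * (\<Sum>b\<in>B. scale3 (c b) (g b))"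
  by (simp add: sum_distrib_left)

lemma subspace_mult_image:
  assumes "forms3.subspace V"
  shows "forms3.subspace ((*) F ` V)"
proof (rule forms3.subspaceI)
  show "0 \<in> (*) F ` V"
    using forms3.subspace_0[OF assms] by force
next
  fix x y assume "x \<in> (*) F ` V" "y \<in> (*) F ` V"
  then show "x + y \<in> (*) F ` V"
    using forms3.subspace_add[OF assms] by (force simp: distrib_left[symmetric])
next
  fix c x assume "x \<in> (*) F ` V"
  then obtain y where "y \<in> V" "x = F * y" by blast
  then show "scale3 c x \<in> (*) F ` V"
    by (intro image_eqI[of _ _ "scale3 c y"] forms3.subspace_scale[OF assms]) simp_all
qed

lemma dim_mult_forms:
  fixes F :: "'a::field poly3"
  assumes "F \<noteq> 0"
  shows "forms3.dim ((*) F ` forms n) = card (degree_triples n)"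
proof -
  obtain A :: "'a poly3 set" where A: "A \<subseteq> forms n" "forms3.independent A" "forms n \<subseteq> forms3.span A"
      "card A = card (degree_triples n)" "finite A"
    using forms3.finite_basis[OF forms_span finite_forms_spanning] dim_forms by metis
  have inj: "inj_on ((*) F) A"
    using assms by (auto simp: inj_on_def)
  show ?thesis
  proof (rule forms3.dim_unique)
    show "(*) F ` A \<subseteq> (*) F ` forms n"
      using A(1) by blast
    show "card ((*) F ` A) = card (degree_triples n)"
      using A(4) card_image[OF inj] by simp
    show "(*) F ` forms n \<subseteq> forms3.span ((*) F ` A)"
    proof clarify
      fix G :: "'a poly3" assume "G \<in> forms n"
      then have "G \<in> forms3.span A" using A(3) by blast
      then obtain u where u: "G = (\<Sum>a\<in>A. scale3 (u a) a)"
        unfolding forms3.span_finite[OF A(5)] by blast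
      have "F * G = (\<Sum>a\<in>A. scale3 (u a) (F * a))"
        by (simp add: u sum_distrib_left)
      then show "F * G \<in> forms3.span ((*) F ` A)"
        by (auto intro!: forms3.span_sum forms3.span_scale intro: forms3.span_base)
    qed
    show "forms3.independent ((*) F ` A)"
    proof (rule forms3.independent_if_scalars_zero)
      fix f x
      assume "(\<Sum>x\<in>(*) F ` A. scale3 (f x) x) = 0" and x: "x \<in> (*) F ` A"
      then have "F * (\<Sum>a\<in>A. scale3 (f (F * a)) a) = 0"
        by (simp add: sum.reindex[OF inj] sum_distrib_left)
      then have "(\<Sum>a\<in>A. scale3 (f (F * a)) a) = 0"
        using assms by simp
      then show "f x = 0"
        using forms3.independentD[OF A(2,5) order_refl, of "\<lambda>a. f (F * a)"] x by auto
    qed (use A in auto)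
  qed
qed

context parametrized_curve
begin

section \<open>Rank and kernel of the restriction to the curve\<close>

definition T :: "nat \<Rightarrow> nat set" where "T n = {degree p | p. p \<in> W n \<and> p \<noteq> 0}"

definition kernel :: "nat \<Rightarrow> 'a poly3 set" where "kernel n = {G \<in> forms n. \<rho> G = 0}"

lemma T_le: "T n \<subseteq> {..n * D}"
  using degree_W by (auto simp: T_def)

lemma finite_T: "finite (T n)"
  using T_le by (rule finite_subset) simp

lemma subspace_kernel: "forms3.subspace (kernel n)"
  unfolding kernel_def
  by (rule forms3.subspaceI)
     (simp_all add: forms_0 forms_add forms_scale subst3_add subst3_scale)

lemma kernel_finite_dim: "kernel n \<subseteq> forms3.span ((\<lambda>(i, j, k). monom3 1 i j k) ` degree_triples n)"
  using forms_span unfolding kernel_def by blast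

text \<open>Rank-nullity for \<rho> on the forms of degree \<open>n\<close>, the rank being counted
  by degrees.\<close>

lemma card_T_kernel: "card (degree_triples n) = card (T n) + forms3.dim (kernel n)"
proof -
  have "{degree (\<rho> x) | x. x \<in> forms n \<and> \<rho> x \<noteq> 0} = T n"
    unfolding T_def W_def by auto
  then show ?thesis
    using forms3.dim_eq_card_degrees(2)[OF subspace_forms forms_span finite_forms_spanning, of \<rho> n]
    by (simp add: subst3_add subst3_scale kernel_def dim_forms)
qed

lemma W_finite_dim: "W n \<subseteq> polys.span ((\<lambda>i. monom 1 i) ` {..n * D})"
  using degree_le_span degree_W by blast

lemma dim_W: "polys.dim (W n) = card (T n)"
proof -
  have "polys.dim {x \<in> W n. x = 0} \<le> card ({} :: 'a poly set)"
    by (rule polys.dim_le_card) auto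
  moreover have "{degree x | x. x \<in> W n \<and> x \<noteq> 0} = T n"
    unfolding T_def ..
  ultimately show ?thesis
    using polys.dim_eq_card_degrees(2)[OF subspace_W W_finite_dim, of n "\<lambda>x. x"] by simp
qed

lemma T_large:
  obtains N where "\<And>j. {..j * D} \<subseteq> T (N + j)"
proof -
  obtain N where N: "\<And>j q. degree q \<le> j * D \<Longrightarrow> q \<in> W (N + j)"
    by (rule all_large_in_W) blast
  have "{..j * D} \<subseteq> T (N + j)" for j
  proof
    fix i assume "i \<in> {..j * D}"
    then have "monom 1 i \<in> W (N + j)"
      by (intro N) (simp add: degree_monom_eq)
    then show "i \<in> T (N + j)"
      unfolding T_def by (intro CollectI exI[of _ "monom 1 i"]) (simp add: degree_monom_eq)
  qed
  then show thesis by (rule that)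
qed

text \<open>If \<open>G\<close> were not divisible by \<open>F\<close>, then the quotient by \<open>(F, G)\<close> would have dimension at most
  \<open>d * m\<close> in every degree, but it maps onto the unbounded spaces \<open>W n\<close>.\<close>

theorem F_dvd:
  assumes G: "G \<in> forms m" "\<rho> G = 0"
  shows "F dvd G"
proof (rule ccontr)
  assume nd: "\<not> F dvd G"
  obtain N where N: "\<And>j. {..j * D} \<subseteq> T (N + j)"
    by (rule T_large) blast
  \<comment> \<open>With this choice \<open>n = N + (d * m + d + m)\<close>, so that
    \<open>T n\<close> has more than \<open>d * m\<close> elements.\<close>
  define k where "k = N + d * m"
  define n where "n = k + d + m"
  let ?U = "(*) F ` forms (k + m)" and ?U' = "(*) F ` forms k"
  have sub: "?U' \<subseteq> forms (k + d)"
    using forms_mult[OF F_form] by (force simp: add.commute)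
  obtain B0 where B0: "B0 \<subseteq> ?U'" "forms3.independent B0" "?U' \<subseteq> forms3.span B0" "card B0 = forms3.dim ?U'" "finite B0"
    by (rule forms3.finite_basis[of ?U' "(\<lambda>(i, j, k). monom3 1 i j k) ` degree_triples (k + d)"])
       (use sub forms_span in auto)
  \<comment> \<open>\<open>B1 - B0\<close> represents a basis of the forms of degree
    \<open>k + d\<close> modulo multiples of \<open>F\<close>. Multiplied by \<open>G\<close> it
    stays independent modulo multiples of \<open>F\<close>, because \<open>F\<close> is prime and
    does not divide \<open>G\<close>.\<close>
  obtain B1 where B1: "B0 \<subseteq> B1" "B1 \<subseteq> forms (k + d)" "forms3.independent B1" "forms (k + d) \<subseteq> forms3.span B1"
    by (rule forms3.maximal_independent_subset_extend[of B0 "forms (k + d)"]) (use sub B0 in auto)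
  have cardB1: "card B1 = card (degree_triples (k + d))"
    using forms3.basis_card_eq_dim[OF B1(2,4,3)] dim_forms by simp
  have finB1: "finite B1"
    using forms3.independent_span_bound[OF finite_forms_spanning B1(3)] B1(2) forms_span by blast
  have "forms3.dim ?U + card (B1 - B0) \<le> forms3.dim (kernel n)"
  proof (rule forms3.independent_family_modulo[OF _ _ _ _ subspace_kernel kernel_finite_dim finite_forms_spanning])
    show "finite (B1 - B0)" using finB1 by simp
    show "forms3.subspace ?U" by (intro subspace_mult_image subspace_forms)
    show "?U \<subseteq> kernel n"
      using forms_mult[OF F_form, of _ "k + m"] by (auto simp: kernel_def subst3_mult n_def add_ac)
    show "(*) G ` (B1 - B0) \<subseteq> kernel n"
      using forms_mult[OF G(1), of _ "k + d"] B1(2) G(2) by (auto simp: kernel_def subst3_mult n_def add_ac)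
    fix c
    assume "(\<Sum>i\<in>B1 - B0. scale3 (c i) (G * i)) \<in> ?U"
    then obtain A where "G * (\<Sum>i\<in>B1 - B0. scale3 (c i) i) = F * A"
      unfolding forms3_sum_scale_mult by blast
    then have "F dvd G * (\<Sum>i\<in>B1 - B0. scale3 (c i) i)"
      by simp
    then have "F dvd (\<Sum>i\<in>B1 - B0. scale3 (c i) i)"
      using prime_elem_dvd_multD[OF prime_F] nd by blast
    then obtain E where E: "(\<Sum>i\<in>B1 - B0. scale3 (c i) i) = F * E" by (rule dvdE)
    have "F * E \<in> forms (k + d)"
      unfolding E[symmetric] using B1(2) by (intro forms_sum forms_scale) auto
    then have "F * E \<in> ?U'"
      using form_cofactor[OF F_form F_nonzero, of E "k + d"] forms_0[of k]
      by (cases "F * E = 0") force+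
    then obtain e where e: "F * E = (\<Sum>i\<in>B0. scale3 (e i) i)"
      using B0(3) unfolding forms3.span_finite[OF B0(5)] by blast
    \<comment> \<open>Both expansions of \<open>F * E\<close> combine to a linear relation on the
      basis \<open>B1\<close>.\<close>
    have "(\<Sum>i\<in>B1. scale3 (if i \<in> B0 then - e i else c i) i) =
        (\<Sum>i\<in>B1 - B0. scale3 (if i \<in> B0 then - e i else c i) i) +
        (\<Sum>i\<in>B0. scale3 (if i \<in> B0 then - e i else c i) i)"
      by (rule sum.subset_diff[OF B1(1) finB1])
    also have "\<dots> = (\<Sum>i\<in>B1 - B0. scale3 (c i) i) + (\<Sum>i\<in>B0. - scale3 (e i) i)"
      by (intro arg_cong2[of _ _ _ _ "(+)"] sum.cong) (auto simp: forms3.scale_minus_left)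
    also have "\<dots> = 0"
      using E e by (simp add: sum_negf)
    finally have "\<forall>i\<in>B1. (if i \<in> B0 then - e i else c i) = 0"
      using forms3.independentD[OF B1(3) finB1 order_refl, of "\<lambda>i. if i \<in> B0 then - e i else c i"] by blast
    then show "\<forall>i\<in>B1 - B0. c i = 0"
      by (metis DiffD1 DiffD2)
  qed
  moreover have "card (B1 - B0) + card (degree_triples k) = card (degree_triples (k + d))"
    using card_Diff_subset[OF B0(5) B1(1)] card_mono[OF finB1 B1(1)] B0(4) cardB1
      dim_mult_forms[OF F_nonzero, of k] by simp
  moreover have "forms3.dim ?U = card (degree_triples (k + m))"
    by (rule dim_mult_forms[OF F_nonzero])
  ultimately have "card (degree_triples (k + m)) + card (degree_triples (k + d)) + card (T n) \<le>
      card (degree_triples n) + card (degree_triples k)"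
    using card_T_kernel[of n] by linarith
  \<comment> \<open>Bezout's count: the second difference of the dimensions of the spaces of forms,
    with steps \<open>d\<close> and \<open>m\<close>, is \<open>d * m\<close>.\<close>
  moreover have "2 * card (degree_triples (k + m)) + 2 * card (degree_triples (k + d)) + 2 * (d * m) =
      2 * card (degree_triples n) + 2 * card (degree_triples k)"
    unfolding card_degree_triples n_def by (simp add: algebra_simps)
  ultimately have "card (T n) \<le> d * m"
    by linarith
  moreover have "{..(d * m + d + m) * D} \<subseteq> T n"
    using N[of "d * m + d + m"] by (simp add: n_def k_def add_ac)
  then have "card {..(d * m + d + m) * D} \<le> card (T n)"
    by (rule card_mono[OF finite_T])
  moreover have "d * m \<le> (d * m + d + m) * D"
    using D_pos by (cases D) auto
  ultimately show False
    by simp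
qed

lemma kernel_eq: "kernel (n + d) = (*) F ` forms n"
proof (intro equalityI subsetI)
  fix G assume "G \<in> kernel (n + d)"
  then have G: "G \<in> forms (n + d)" "\<rho> G = 0"
    by (auto simp: kernel_def)
  then obtain A where A: "G = F * A"
    using F_dvd by (meson dvdE)
  then show "G \<in> (*) F ` forms n"
    using form_cofactor[OF F_form F_nonzero, of A "n + d"] G(1) forms_0[of n]
    by (cases "F * A = 0") force+
next
  fix G assume "G \<in> (*) F ` forms n"
  then show "G \<in> kernel (n + d)"
    using forms_mult[OF F_form, of _ n] by (auto simp: kernel_def subst3_mult add.commute[of n d])
qed

section \<open>Arithmetic genus, Hilbert function and degree of the parametrization\<close>

definition \<delta> :: nat where "\<delta> = (d - 1) * (d - 2) div 2"

lemma \<delta>: "2 * \<delta> = (d - 1) * (d - 2)"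
proof -
  have "even ((d - 1) * (d - 2))" by (cases "d \<le> 1") auto
  then show ?thesis by (simp add: \<delta>_def)
qed

text \<open>The Hilbert function of a plane curve of degree \<open>d\<close> and arithmetic genus
  \<delta>, from the kernel of the restriction being \<open>F\<close> times the forms of degree
  \<open>n\<close>.\<close>

lemma card_T: "card (T (n + d)) + \<delta> = (n + d) * d + 1"
proof -
  have *: "card (degree_triples (n + d)) = card (T (n + d)) + card (degree_triples n)"
    using card_T_kernel[of "n + d"] by (simp add: kernel_eq dim_mult_forms[OF F_nonzero])
  obtain e where d: "d = Suc e"
    using d_pos by (cases d) auto
  have "(n + d + 1) * (n + d + 2) = 2 * card (T (n + d)) + (n + 1) * (n + 2)"
    using * card_degree_triples[of n] card_degree_triples[of "n + d"] by linarith
  moreover have "(n + d + 1) * (n + d + 2) + 2 * \<delta> = 2 * ((n + d) * d + 1) + (n + 1) * (n + 2)"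
    unfolding \<delta> unfolding d by (cases e) (simp_all add: algebra_simps)
  ultimately have "2 * card (T (n + d)) + (n + 1) * (n + 2) + 2 * \<delta> = 2 * ((n + d) * d + 1) + (n + 1) * (n + 2)"
    by simp
  then show ?thesis
    by simp
qed

text \<open>The dimension of \<open>W n\<close> grows linearly with slope \<open>d\<close> by the
  Hilbert function, and with slope \<open>D\<close> because it lies between two linear bounds of
  that slope.\<close>

lemma D_eq_d: "D = d"
proof -
  obtain N where N: "\<And>j. {..j * D} \<subseteq> T (N + j)"
    by (rule T_large) blast
  have ge: "Suc (j * D) \<le> card (T (N + j))" for j
    using card_mono[OF finite_T N[of j]] by simp
  have le: "card (T n) \<le> Suc (n * D)" for n
    using card_mono[OF _ T_le[of n]] by simp
  show ?thesis
  proof (rule antisym)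
    show "D \<le> d"
    proof (rule ccontr)
      assume "\<not> D \<le> d"
      \<comment> \<open>If \<open>D > d\<close>, comparing the two counts forces
        \<open>j \<le> N * d\<close>, which this \<open>j\<close> violates.\<close>
      define j where "j = N * d + d"
      have "j * D + \<delta> \<le> (N + j) * d"
        using ge[of j] card_T[of "N + N * d"] by (simp add: j_def add_ac)
      moreover have "j * D \<ge> j * Suc d"
        using \<open>\<not> D \<le> d\<close> by (intro mult_left_mono) auto
      ultimately have "j * Suc d \<le> (N + j) * d" by linarith
      then show False
        using d_pos by (simp add: j_def algebra_simps)
    qed
    show "d \<le> D"
    proof (rule ccontr)
      assume "\<not> d \<le> D"
      \<comment> \<open>If \<open>D < d\<close>, then in degree \<open>\<delta> + d\<close> the gap
        between the slopes exceeds the defect \<delta>.\<close>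
      have "(\<delta> + d) * d \<le> (\<delta> + d) * D + \<delta>"
        using le[of "\<delta> + d"] card_T[of \<delta>] by simp
      moreover have "(\<delta> + d) * d \<ge> (\<delta> + d) * Suc D"
        using \<open>\<not> d \<le> D\<close> by (intro mult_left_mono) auto
      ultimately show False
        using d_pos by simp
    qed
  qed
qed

section \<open>Orders of vanishing at the distinguished point\<close>

definition orders :: "nat \<Rightarrow> nat set" where "orders n = {k. k \<le> n * d \<and> n * d - k \<in> T n}"

definition gaps :: "nat \<Rightarrow> nat set" where "gaps n = {..n * d} - orders n"

lemma orders_iff:
  "k \<in> orders n \<longleftrightarrow> (\<exists>G\<in>forms n. \<rho> G \<noteq> 0 \<and> degree (\<rho> G) + k = n * d)"
proof
  assume "k \<in> orders n"
  then show "\<exists>G\<in>forms n. \<rho> G \<noteq> 0 \<and> degree (\<rho> G) + k = n * d"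
    unfolding orders_def T_def W_def by force
next
  assume "\<exists>G\<in>forms n. \<rho> G \<noteq> 0 \<and> degree (\<rho> G) + k = n * d"
  then obtain G where "G \<in> forms n" "\<rho> G \<noteq> 0" "degree (\<rho> G) + k = n * d" by blast
  then show "k \<in> orders n"
    unfolding orders_def T_def W_def by (auto intro!: exI[of _ "\<rho> G"])
qed

lemma orders_add: "k \<in> orders m \<Longrightarrow> l \<in> orders n \<Longrightarrow> k + l \<in> orders (m + n)"
proof -
  assume "k \<in> orders m" "l \<in> orders n"
  then obtain G H where "G \<in> forms m" "\<rho> G \<noteq> 0" "degree (\<rho> G) + k = m * d"
      "H \<in> forms n" "\<rho> H \<noteq> 0" "degree (\<rho> H) + l = n * d"
    unfolding orders_iff by blast
  then show ?thesis
    unfolding orders_iff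
    by (intro bexI[of _ "G * H"] forms_mult) (auto simp: subst3_mult degree_mult_eq algebra_simps)
qed

lemma linear_form_off_P:
  obtains L where "L \<in> forms 1" "eval3 L P \<noteq> 0"
  by (rule coprime_linear_forms) blast

lemma zero_in_orders: "0 \<in> orders n"
proof -
  obtain L where L: "L \<in> forms 1" "eval3 L P \<noteq> 0"
    by (rule linear_form_off_P)
  then have "L ^ n \<in> forms n" "eval3 (L ^ n) P \<noteq> 0"
    using forms_power[OF L(1), of n] by (simp_all add: eval3_power del: eval3.simps)
  then show ?thesis
    unfolding orders_iff using degree_\<rho>[of "L ^ n" n] by (auto simp: D_eq_d)
qed

text \<open>Multiplication by powers of a linear form that does not vanish at \<open>P\<close>
  raises the degree of a form and keeps its order.\<close>

lemma orders_mono: "m \<le> n \<Longrightarrow> orders m \<subseteq> orders n"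
  using orders_add[OF _ zero_in_orders, of _ m "n - m"] by auto

text \<open>Reflection at \<open>n * d\<close> matches orders with the degrees in
  \<open>T n\<close>, whose number is known from the Hilbert function.\<close>

lemma card_gaps: "d \<le> n \<Longrightarrow> card (gaps n) = \<delta>"
proof -
  assume "d \<le> n"
  have "card (orders n) = card (T n)"
    using T_le[of n] unfolding D_eq_d
    by (intro bij_betw_same_card[of "\<lambda>k. n * d - k"] bij_betwI[of _ _ _ "\<lambda>k. n * d - k"])
       (auto simp: orders_def)
  moreover have "card (gaps n) = card {..n * d} - card (orders n)"
    unfolding gaps_def by (rule card_Diff_subset) (auto simp: orders_def intro: finite_subset[of _ "{..n * d}"])
  ultimately show ?thesis
    using card_T[of "n - d"] \<open>d \<le> n\<close> by simp
qed

lemma finite_gaps: "finite (gaps n)"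
  by (simp add: gaps_def)

text \<open>An order of at least \<open>N * d\<close> in degree \<open>n\<close> corresponds to a
  restriction of degree at most \<open>(n - N) * d\<close>, and all these degrees occur.\<close>

lemma orders_large:
  obtains N where "\<And>k n. N * d \<le> k \<Longrightarrow> k \<le> n * d \<Longrightarrow> k \<in> orders n"
proof -
  obtain N where N: "\<And>j. {..j * D} \<subseteq> T (N + j)"
    by (rule T_large) blast
  have "k \<in> orders n" if "N * d \<le> k" "k \<le> n * d" for k n
  proof -
    have "N * d \<le> n * d" using that by linarith
    then have "N \<le> n" using d_pos by simp
    moreover have "n * d - k \<le> (n - N) * d"
      using that by (simp add: diff_mult_distrib)
    ultimately have "n * d - k \<in> T n"
      using N[of "n - N"] by (auto simp: D_eq_d)
    then show ?thesis
      using that by (simp add: orders_def)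
  qed
  then show thesis by (rule that)
qed

lemma small_gap: "(d - 1) * (d - 2) < d * d"
proof -
  have "(d - 1) * (d - 2) \<le> (d - 1) * d"
    by (intro mult_left_mono) auto
  also have "\<dots> < d * d"
    using d_pos by simp
  finally show ?thesis .
qed

text \<open>The orders of vanishing at \<open>P\<close> form a numerical semigroup with exactly \<open>\<delta>\<close> gaps. If \<open>c\<close> is a gap,
  then one of \<open>i\<close> and \<open>c - i\<close> is a gap for every \<open>i \<le> c\<close>, so all gaps are smaller than
  \<open>2 * \<delta> = (d - 1) * (d - 2)\<close>.\<close>

theorem square_in_orders: "d * d \<in> orders d"
proof -
  obtain N where N: "\<And>k n. N * d \<le> k \<Longrightarrow> k \<le> n * d \<Longrightarrow> k \<in> orders n"
    by (rule orders_large) blast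
  define M where "M = max N d"
  have bound: "k < N * d" if "k \<in> gaps n" for k n
    using N[of k n] that by (force simp: gaps_def)
  \<comment> \<open>From degree \<open>M\<close> on the gaps do not change: they lie below
    \<open>N * d\<close>, can only disappear as the degree grows, and their number stays
    \<delta>.\<close>
  have gaps_eq: "gaps n = gaps M" if "n \<ge> M" for n
  proof (rule card_subset_eq[OF finite_gaps])
    show "gaps n \<subseteq> gaps M"
    proof
      fix k assume k: "k \<in> gaps n"
      have "N * d \<le> M * d" by (simp add: M_def)
      with bound[OF k] have "k \<le> M * d" by linarith
      then show "k \<in> gaps M"
        using k orders_mono[OF that] by (auto simp: gaps_def)
    qed
    show "card (gaps n) = card (gaps M)"
      using card_gaps[of n] card_gaps[of M] that by (simp add: M_def)
  qed
  have small: "c < 2 * \<delta>" if c: "c \<in> gaps M" for c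
  proof -
    have "{..c} \<subseteq> gaps M \<union> (\<lambda>i. c - i) ` gaps M"
    proof
      fix i assume i: "i \<in> {..c}"
      show "i \<in> gaps M \<union> (\<lambda>i. c - i) ` gaps M"
      proof (rule ccontr)
        assume no: "i \<notin> gaps M \<union> (\<lambda>i. c - i) ` gaps M"
        have "c - i \<notin> gaps M"
        proof
          assume "c - i \<in> gaps M"
          then have "c - (c - i) \<in> (\<lambda>i. c - i) ` gaps M" by blast
          then show False using no i by simp
        qed
        moreover have "i \<le> M * d" "c - i \<le> M * d"
          using c i by (auto simp: gaps_def)
        ultimately have "i \<in> orders M" "c - i \<in> orders M"
          using no by (auto simp: gaps_def)
        then have "i + (c - i) \<in> orders (M + M)"
          by (rule orders_add)
        then have "c \<notin> gaps (M + M)"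
          using i by (simp add: gaps_def)
        then show False
          using c gaps_eq[of "M + M"] by simp
      qed
    qed
    then have "card {..c} \<le> card (gaps M \<union> (\<lambda>i. c - i) ` gaps M)"
      by (intro card_mono) (simp_all add: finite_gaps)
    also have "\<dots> \<le> card (gaps M) + card (gaps M)"
      by (meson card_Un_le card_image_le[OF finite_gaps] add_left_mono le_trans)
    also have "\<dots> = 2 * \<delta>"
      using card_gaps[of M] by (simp add: M_def)
    finally show ?thesis by simp
  qed
  then have less: "c < d * d" if "c \<in> gaps M" for c
    using that small_gap \<delta> by fastforce
  \<comment> \<open>The gaps in degree \<open>M\<close> lie below \<open>d * d\<close>, hence in the
    range considered in degree \<open>d\<close>, where they are gaps as well; equal numbers then
    give equality.\<close>
  have "gaps M = gaps d"
  proof (rule card_subset_eq[OF finite_gaps])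
    show "gaps M \<subseteq> gaps d"
      using less orders_mono[of d M] by (force simp: gaps_def M_def)
    show "card (gaps M) = card (gaps d)"
      using card_gaps[of d] card_gaps[of M] by (simp add: M_def)
  qed
  then have "d * d \<notin> gaps d"
    using less by blast
  then show ?thesis
    by (simp add: gaps_def)
qed

text \<open>Order \<open>d * d\<close> leaves degree 0 for the restriction. Such a form is a second
  generator of the pencil, next to \<open>F\<close>.\<close>

lemma form_meeting_only_P:
  obtains G c where "G \<in> forms d" "c \<noteq> 0" "\<rho> G = [:c:]"
proof -
  obtain G where G: "G \<in> forms d" "\<rho> G \<noteq> 0" "degree (\<rho> G) + d * d = d * d"
    using square_in_orders unfolding orders_iff by blast
  then obtain c where "\<rho> G = [:c:]"
    using degree_eq_zeroE[of "\<rho> G"] by auto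
  with G show thesis
    using that[of G c] by auto
qed

end

subsection \<open>Intersection numbers and the pencil\<close>

definition point_of :: "'a::field \<times> 'a \<times> 'a \<Rightarrow> 'a point" where
  "point_of v = {mult_triple c v | c. c \<noteq> 0}"

lemma hpoint_eq_point_of: "hpoint x y z = point_of (x, y, z)"
  by (simp add: hpoint_def point_of_def)

lemma in_point_of: "v \<in> point_of v"
  unfolding point_of_def by (intro CollectI exI[of _ 1]) simp

lemma proj_plane_eq: "proj_plane = point_of ` {v. v \<noteq> (0, 0, 0)}"
  by (force simp: proj_plane_def hpoint_eq_point_of)

lemma point_of_mult_triple:
  assumes "c \<noteq> 0"
  shows "point_of (mult_triple c v) = point_of v"
proof (intro equalityI subsetI)
  fix u assume "u \<in> point_of (mult_triple c v)"
  then obtain b where "b \<noteq> 0" "u = mult_triple (b * c) v"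
    by (auto simp: point_of_def mult_triple_mult)
  then show "u \<in> point_of v"
    using assms by (auto simp: point_of_def)
next
  fix u assume "u \<in> point_of v"
  then obtain b where "b \<noteq> 0" "u = mult_triple b v"
    by (auto simp: point_of_def)
  then have "u = mult_triple (b / c) (mult_triple c v)" "b / c \<noteq> 0"
    using assms by (simp_all add: mult_triple_mult)
  then show "u \<in> point_of (mult_triple c v)"
    unfolding point_of_def by blast
qed

lemma vanishes_at_point_of:
  assumes "G \<in> forms n"
  shows "vanishes_at G (point_of v) \<longleftrightarrow> eval3 G v = 0"
proof
  assume "vanishes_at G (point_of v)"
  then show "eval3 G v = 0"
    using in_point_of unfolding vanishes_at_def by blast
next
  assume v: "eval3 G v = 0"
  have "eval3 G (mult_triple c v) = 0" for c
    unfolding eval3_mult_triple[OF assms] v by simp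
  then show "vanishes_at G (point_of v)"
    unfolding vanishes_at_def point_of_def by blast
qed

lemma point_of_in_supp:
  assumes "G \<in> forms n"
  shows "point_of v \<in> supp (div_of G) \<longleftrightarrow> point_of v \<in> proj_plane \<and> eval3 G v = 0"
proof -
  have "(\<forall>H\<in>div_of G. vanishes_at H (point_of v)) \<longleftrightarrow> (\<forall>H\<in>div_of G. eval3 H v = 0)"
    using div_of_subset_forms[OF assms] vanishes_at_point_of by blast
  also have "\<dots> \<longleftrightarrow> eval3 G v = 0"
    using self_in_div_of[of G] by (auto simp: div_of_def eval3_scale simp del: eval3.simps)
  finally show ?thesis
    by (simp add: supp_def)
qed

section \<open>Fractions with a common denominator\<close>

lemma Fract_add_same:
  fixes a b c :: "'a::idom"
  assumes "c \<noteq> 0"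
  shows "Fract a c + Fract b c = Fract (a + b) c"
  using mult_fract_cancel[OF assms, of "a + b" c]
  by (simp add: add_fract[OF assms assms] distrib_left mult.commute)

lemma sum_Fract:
  fixes H :: "'a::field poly3"
  assumes "H \<noteq> 0"
  shows "(\<Sum>i\<in>I. Fract (const3 (c i)) 1 * Fract (g i) H) = Fract (\<Sum>i\<in>I. scale3 (c i) (g i)) H"
proof (induction I rule: infinite_finite_induct)
  case (insert i I)
  have "Fract (const3 (c i)) 1 * Fract (g i) H = Fract (scale3 (c i) (g i)) H"
    by (simp add: scale3_def)
  then show ?case
    by (simp only: sum.insert[OF insert.hyps] insert.IH Fract_add_same[OF assms])
qed (simp_all add: fract_collapse)

text \<open>Multiplication by \<open>p\<close> shifts the set of degrees by \<open>degree p\<close>,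
  and the dimension is the number of degrees.\<close>

lemma dim_mult_polys:
  fixes p :: "'a::field poly"
  assumes "p \<noteq> 0" "polys.subspace V" "V \<subseteq> {q. degree q \<le> n}"
  shows "polys.subspace ((*) p ` V)" and "polys.dim ((*) p ` V) = polys.dim V"
proof -
  have dim: "polys.dim V' = card {degree q | q. q \<in> V' \<and> q \<noteq> 0}"
    if "polys.subspace V'" "V' \<subseteq> {q. degree q \<le> m}" for V' :: "'a poly set" and m
  proof -
    have "polys.dim {x \<in> V'. x = 0} \<le> card ({} :: 'a poly set)"
      by (rule polys.dim_le_card) auto
    then show ?thesis
      using polys.dim_eq_card_degrees(2)[OF that(1) order_trans[OF that(2) degree_le_span], of "\<lambda>x. x"] by simp
  qed
  show sub: "polys.subspace ((*) p ` V)"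
  proof (rule polys.subspaceI)
    show "0 \<in> (*) p ` V"
      using polys.subspace_0[OF assms(2)] by force
  next
    fix x y assume "x \<in> (*) p ` V" "y \<in> (*) p ` V"
    then obtain u v where "u \<in> V" "x = p * u" "v \<in> V" "y = p * v" by blast
    then show "x + y \<in> (*) p ` V"
      by (intro image_eqI[of _ _ "u + v"] polys.subspace_add[OF assms(2)]) (simp_all add: distrib_left)
  next
    fix c x assume "x \<in> (*) p ` V"
    then obtain y where "y \<in> V" "x = p * y" by blast
    then show "smult c x \<in> (*) p ` V"
      by (intro image_eqI[of _ _ "smult c y"] polys.subspace_scale[OF assms(2)]) simp_all
  qed
  have "{degree q | q. q \<in> (*) p ` V \<and> q \<noteq> 0} = (\<lambda>q. degree (p * q)) ` (V - {0})"
    using assms(1) by auto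
  also have "\<dots> = (\<lambda>q. degree p + degree q) ` (V - {0})"
    using assms(1) by (intro image_cong) (auto simp: degree_mult_eq)
  also have "\<dots> = (+) (degree p) ` {degree q | q. q \<in> V \<and> q \<noteq> 0}"
    by auto
  finally have "{degree q | q. q \<in> (*) p ` V \<and> q \<noteq> 0} = (+) (degree p) ` {degree q | q. q \<in> V \<and> q \<noteq> 0}" .
  moreover have "(*) p ` V \<subseteq> {q. degree q \<le> degree p + n}"
  proof clarify
    fix q assume "q \<in> V"
    then have "degree q \<le> n"
      using assms(3) by blast
    then show "degree (p * q) \<le> degree p + n"
      using degree_mult_le[of p q] by linarith
  qed
  ultimately show "polys.dim ((*) p ` V) = polys.dim V"
    using dim[OF sub] dim[OF assms(2,3)] by (simp add: card_image)
qed

context parametrized_curve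
begin

section \<open>Lower bound for intersection numbers\<close>

abbreviation C :: "'a divisor" where "C \<equiv> div_of F"

abbreviation Q :: "'a point" where "Q \<equiv> point_of P"

lemma not_vanishes_at_Q: "H \<in> forms n \<Longrightarrow> \<not> vanishes_at H Q \<Longrightarrow> H \<noteq> 0 \<and> \<rho> H \<noteq> 0 \<and> degree (\<rho> H) = n * d"
  using degree_\<rho>[of H n] by (auto simp: vanishes_at_point_of D_eq_d simp del: eval3.simps)

text \<open>The Apery set of the semigroup of orders with respect to \<open>d * d\<close>.\<close>

definition least_order :: "nat \<Rightarrow> nat" where
  "least_order r = (LEAST k. (\<exists>n. k \<in> orders n) \<and> k mod (d * d) = r)"

lemma least_order:
  assumes "r < d * d"
  shows "\<exists>n. least_order r \<in> orders n" "least_order r mod (d * d) = r"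
    and "\<And>k n. k \<in> orders n \<Longrightarrow> k mod (d * d) = r \<Longrightarrow> least_order r \<le> k"
proof -
  obtain N where N: "\<And>k n. N * d \<le> k \<Longrightarrow> k \<le> n * d \<Longrightarrow> k \<in> orders n"
    by (rule orders_large) blast
  \<comment> \<open>A number in the residue class of \<open>r\<close> beyond the bound
    \<open>N * d\<close>; as \<open>k \<le> k * d\<close>, it is an order of a form of degree
    \<open>k\<close>.\<close>
  define k where "k = N * (d * d) + r"
  have "N * d \<le> k" "k \<le> k * d"
    using d_pos by (auto simp: k_def trans_le_add1)
  then have "k \<in> orders k" by (rule N)
  then have "(\<exists>n. k \<in> orders n) \<and> k mod (d * d) = r"
    using assms by (auto simp: k_def)
  then have "(\<exists>n. least_order r \<in> orders n) \<and> least_order r mod (d * d) = r"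
    unfolding least_order_def by (rule LeastI)
  then show "\<exists>n. least_order r \<in> orders n" "least_order r mod (d * d) = r"
    by auto
  show "\<And>k n. k \<in> orders n \<Longrightarrow> k mod (d * d) = r \<Longrightarrow> least_order r \<le> k"
    unfolding least_order_def by (rule Least_le) blast
qed

text \<open>Elements of the local ring whose orders along the curve are the least ones in each residue class
  modulo \<open>d * d\<close> stay independent modulo \<open>F\<close> and \<open>G\<close>, because \<open>G\<close> itself has order \<open>d * d\<close>
  (or vanishes on the curve).\<close>

lemma intersection_number_ge:
  assumes G: "G \<in> forms d" "G \<noteq> 0" "\<rho> G = [:e:]"
  shows "intersection_number Q C (div_of G) \<ge> enat (d * d)"
proof -
  let ?R = "{..<d * d}"
  have "\<exists>n. \<forall>r\<in>?R. least_order r \<in> orders (n r)"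
    by (rule bchoice) (auto intro: least_order(1))
  then obtain nn where nn: "least_order r \<in> orders (nn r)" if "r < d * d" for r
    by auto
  \<comment> \<open>A single degree in which all the least orders occur.\<close>
  define n where "n = sum nn ?R"
  have "least_order r \<in> orders n" if "r < d * d" for r
    using nn[OF that] orders_mono[of "nn r" n] member_le_sum[of r ?R nn] that by (auto simp: n_def)
  then have "\<exists>g. \<forall>r\<in>?R. g r \<in> forms n \<and> \<rho> (g r) \<noteq> 0 \<and> degree (\<rho> (g r)) + least_order r = n * d"
    by (intro bchoice) (auto simp: orders_iff)
  then obtain g where g: "g r \<in> forms n" "\<rho> (g r) \<noteq> 0" "degree (\<rho> (g r)) + least_order r = n * d"
    if "r < d * d" for r by auto
  obtain L where L: "L \<in> forms 1" "eval3 L P \<noteq> 0"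
    by (rule linear_form_off_P)
  define H where "H = L ^ n"
  have H: "H \<in> forms n" "\<not> vanishes_at H Q"
    using forms_power[OF L(1), of n] L(2)
    by (auto simp: H_def eval3_power vanishes_at_point_of simp del: eval3.simps)
  then have H': "H \<noteq> 0" "\<rho> H \<noteq> 0" "degree (\<rho> H) = n * d"
    using not_vanishes_at_Q by blast+
  define b where "b r = Fract (g r) H" for r
  have inj: "inj_on b ?R"
  proof (rule inj_onI)
    fix r s assume rs: "r \<in> ?R" "s \<in> ?R" "b r = b s"
    then have "g r * H = g s * H"
      unfolding b_def using eq_fract(1)[OF H'(1) H'(1)] by blast
    then have "g r = g s"
      using mult_right_cancel[OF H'(1)] by blast
    moreover have "r < d * d" "s < d * d"
      using rs by auto
    ultimately have "least_order r = least_order s"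
      using g(3)[of r] g(3)[of s] by (metis add_left_cancel)
    then show "r = s"
      using least_order(2)[OF \<open>r < d * d\<close>] least_order(2)[OF \<open>s < d * d\<close>] by metis
  qed
  have indep: "independent_modulo (intersection_ideal Q C (div_of G)) (b ` ?R)"
    unfolding independent_modulo_def
  proof (intro allI impI)
    fix c
    assume "(\<Sum>x\<in>b ` ?R. Fract (const3 (c x)) 1 * x) \<in> intersection_ideal Q C (div_of G)"
    define G' where "G' = (\<Sum>r\<in>?R. scale3 (c (b r)) (g r))"
    have "(\<Sum>x\<in>b ` ?R. Fract (const3 (c x)) 1 * x) = (\<Sum>r\<in>?R. Fract (const3 (c (b r))) 1 * b r)"
      by (simp only: sum.reindex[OF inj] o_def)
    also have "\<dots> = (\<Sum>r\<in>?R. Fract (const3 (c (b r))) 1 * Fract (g r) H)"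
      by (subst (2) b_def) (rule refl)
    also have "\<dots> = Fract G' H"
      unfolding G'_def by (rule sum_Fract[OF H'(1)])
    finally have "(\<Sum>x\<in>b ` ?R. Fract (const3 (c x)) 1 * x) = Fract G' H" .
    with \<open>_ \<in> intersection_ideal Q C (div_of G)\<close>
    obtain u v f h where *: "Fract G' H = u * f + v * h" "u \<in> local_ring Q" "v \<in> local_ring Q"
        "f \<in> local_equations Q C" "h \<in> local_equations Q (div_of G)"
      unfolding intersection_ideal_def by auto
    obtain U H1 n1 where u: "u = Fract U H1" "H1 \<in> forms n1" "\<not> vanishes_at H1 Q"
      using *(2) unfolding local_ring_def by blast
    obtain V H3 n3 where v: "v = Fract V H3" "V \<in> forms n3" "H3 \<in> forms n3" "\<not> vanishes_at H3 Q"
      using *(3) unfolding local_ring_def by blast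
    obtain f' H2 n2 where f: "f = Fract f' H2" "f' \<in> C" "H2 \<in> forms n2" "\<not> vanishes_at H2 Q"
      using *(4) unfolding local_equations_def by blast
    obtain h' H4 n4 where h: "h = Fract h' H4" "h' \<in> div_of G" "h' \<in> forms n4" "H4 \<in> forms n4"
        "\<not> vanishes_at H4 Q"
      using *(5) unfolding local_equations_def by blast
    obtain f0 where f0: "f' = scale3 f0 F"
      using f(2) by (auto simp: div_of_def)
    obtain h0 where h0: "h' = scale3 h0 G" "h0 \<noteq> 0"
      using h(2) by (auto simp: div_of_def)
    have "h' \<in> forms d" "h' \<noteq> 0"
      using G h0 by (auto simp: forms_scale)
    then have n4: "n4 = d"
      using forms_degree_unique h(3) by blast
    note H1 = not_vanishes_at_Q[OF u(2,3)] and H2 = not_vanishes_at_Q[OF f(3,4)]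
      and H3 = not_vanishes_at_Q[OF v(3,4)] and H4 = not_vanishes_at_Q[OF h(4,5)]
    have nz: "H1 * H2 \<noteq> 0" "H3 * H4 \<noteq> 0"
      using H1 H2 H3 H4 by simp_all
    have "Fract G' H = Fract (U * f') (H1 * H2) + Fract (V * h') (H3 * H4)"
      unfolding *(1) u(1) v(1) f(1) h(1) by (simp only: mult_fract)
    also have "\<dots> = Fract ((U * f') * (H3 * H4) + (V * h') * (H1 * H2)) ((H1 * H2) * (H3 * H4))"
      using nz by (rule add_fract)
    finally have "G' * ((H1 * H2) * (H3 * H4)) = ((U * f') * (H3 * H4) + (V * h') * (H1 * H2)) * H"
      using eq_fract(1)[OF H'(1) no_zero_divisors[OF nz]] by blast
    \<comment> \<open>Restriction to the curve kills the summand with \<open>F\<close> and turns the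
      equation of \<open>G\<close> into the constant \<open>e\<close>.\<close>
    then have "\<rho> (G' * ((H1 * H2) * (H3 * H4))) = \<rho> (((U * f') * (H3 * H4) + (V * h') * (H1 * H2)) * H)"
      by simp
    then have "(\<rho> H1 * \<rho> H2) * (\<rho> G' * (\<rho> H3 * \<rho> H4)) = (\<rho> H1 * \<rho> H2) * (smult (h0 * e) (\<rho> V) * \<rho> H)"
      by (simp add: subst3_mult subst3_add f0 h0(1) subst3_scale G(3) algebra_simps)
    moreover have "\<rho> H1 * \<rho> H2 \<noteq> 0"
      using H1 H2 by simp
    ultimately have eq: "\<rho> G' * (\<rho> H3 * \<rho> H4) = smult (h0 * e) (\<rho> V) * \<rho> H"
      by (meson mult_left_cancel)
    have G': "\<rho> G' = (\<Sum>r\<in>?R. smult (c (b r)) (\<rho> (g r)))"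
      by (simp add: G'_def subst3_sum subst3_scale)
    show "\<forall>x\<in>b ` ?R. c x = 0"
    proof (rule ccontr)
      assume "\<not> (\<forall>x\<in>b ` ?R. c x = 0)"
      then obtain r0 where "r0 < d * d \<and> c (b r0) \<noteq> 0" by auto
      \<comment> \<open>Among the terms with nonzero scalar, the one of least order has the largest
        degree and determines the degree of \<open>\<rho> G'\<close>.\<close>
      then obtain r where r: "r < d * d" "c (b r) \<noteq> 0"
          and min: "\<And>s. s < d * d \<Longrightarrow> c (b s) \<noteq> 0 \<Longrightarrow> least_order r \<le> least_order s"
        using ex_has_least_nat[of "\<lambda>s. s < d * d \<and> c (b s) \<noteq> 0" r0 least_order] by blast
      define m where "m = degree (\<rho> (g r))"
      have deg: "degree (smult (c (b s)) (\<rho> (g s))) \<le> m" if "s < d * d" for s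
        using min[OF that] g(3)[OF that] g(3)[OF r(1)] by (cases "c (b s) = 0") (auto simp: m_def)
      have other: "coeff (smult (c (b s)) (\<rho> (g s))) m = 0" if "s < d * d" "s \<noteq> r" for s
      proof (cases "c (b s) = 0")
        case False
        have "least_order s \<noteq> least_order r"
          using least_order(2)[OF that(1)] least_order(2)[OF r(1)] that(2) by metis
        then have "degree (\<rho> (g s)) < m"
          using min[OF that(1) False] g(3)[OF that(1)] g(3)[OF r(1)] by (simp add: m_def)
        then show ?thesis
          by (simp add: coeff_eq_0)
      qed simp
      have "coeff (\<rho> G') m = (\<Sum>s\<in>?R. coeff (smult (c (b s)) (\<rho> (g s))) m)"
        by (simp add: G' coeff_sum)
      also have "\<dots> = coeff (smult (c (b r)) (\<rho> (g r))) m + (\<Sum>s\<in>?R - {r}. coeff (smult (c (b s)) (\<rho> (g s))) m)"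
        using r(1) by (intro sum.remove) auto
      also have "(\<Sum>s\<in>?R - {r}. coeff (smult (c (b s)) (\<rho> (g s))) m) = 0"
        using other by (intro sum.neutral) auto
      finally have "coeff (\<rho> G') m \<noteq> 0"
        using r(2) g(2)[OF r(1)] by (simp add: m_def)
      moreover have "degree (\<rho> G') \<le> m"
        unfolding G' using deg by (intro degree_sum_le) auto
      ultimately have dG': "\<rho> G' \<noteq> 0" "degree (\<rho> G') = m"
        using le_degree[of "\<rho> G'" m] by auto
      have ne: "h0 * e \<noteq> 0" "\<rho> V \<noteq> 0"
        using eq dG'(1) H3 H4 by auto
      have "m + (n3 * d + d * d) = degree (\<rho> V) + n * d"
        using arg_cong[OF eq, of degree] dG' H3 H4 ne H' by (simp add: degree_mult_eq n4)
      then have order: "least_order r + degree (\<rho> V) = n3 * d + d * d"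
        using g(3)[OF r(1)] unfolding m_def by linarith
      \<comment> \<open>The order of \<open>V\<close>. Comparing degrees gives
        \<open>least_order r = d * d + s\<close>, so \<open>s\<close> is a smaller order in the same
        residue class.\<close>
      define s where "s = n3 * d - degree (\<rho> V)"
      have "degree (\<rho> V) \<le> n3 * d"
        using \<rho>_form(1)[OF v(2)] by (simp add: D_eq_d)
      then have s: "degree (\<rho> V) + s = n3 * d" "least_order r = d * d + s"
        using order by (simp_all add: s_def)
      have "s \<in> orders n3"
        unfolding orders_iff using v(2) ne(2) s(1) by blast
      moreover have "s mod (d * d) = r"
        using least_order(2)[OF r(1)] s(2) by simp
      ultimately have "least_order r \<le> s"
        by (rule least_order(3)[OF r(1)])
      then show False
        using s(2) d_pos by simp
    qed
  qed
  have "b ` ?R \<subseteq> local_ring Q"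
    using g(1) H by (auto simp: b_def local_ring_def)
  then have "enat (card (b ` ?R)) \<le> intersection_number Q C (div_of G)"
    unfolding intersection_number_def using indep by (intro Sup_upper) blast
  then show ?thesis
    by (simp add: card_image[OF inj])
qed

section \<open>Upper bound for intersection numbers\<close>

lemma common_denominator:
  assumes "finite B" "B \<subseteq> local_ring Q"
  shows "\<exists>n H. H \<in> forms n \<and> eval3 H P \<noteq> 0 \<and> (\<forall>b\<in>B. \<exists>A\<in>forms n. b = Fract A H)"
  using assms
proof (induction B rule: finite_induct)
  case empty
  show ?case
    using one_in_forms by (intro exI[of _ 0] exI[of _ 1]) auto
next
  case (insert b B)
  then obtain n H where H: "H \<in> forms n" "eval3 H P \<noteq> 0" "\<And>b. b \<in> B \<Longrightarrow> \<exists>A\<in>forms n. b = Fract A H"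
    by auto
  obtain A' H' n' where b: "b = Fract A' H'" "A' \<in> forms n'" "H' \<in> forms n'" "eval3 H' P \<noteq> 0"
    using insert.prems unfolding local_ring_def by (auto simp: vanishes_at_point_of simp del: eval3.simps)
  have nz: "H \<noteq> 0" "H' \<noteq> 0"
    using H(2) b(4) by (auto simp del: eval3.simps)
  have "\<exists>A\<in>forms (n + n'). x = Fract A (H * H')" if x: "x \<in> insert b B" for x
  proof (cases "x = b")
    case True
    have "x = Fract (H * A') (H * H')"
      by (simp only: True b(1) mult_fract_cancel[OF nz(1)])
    then show ?thesis
      using forms_mult[OF H(1) b(2)] by blast
  next
    case False
    then obtain A where "A \<in> forms n" "x = Fract A H"
      using H(3)[of x] x by blast
    moreover from this have "x = Fract (A * H') (H * H')"
      by (simp only: mult.commute[of _ H'] mult_fract_cancel[OF nz(2)])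
    ultimately show ?thesis
      using forms_mult[OF _ b(3)] by blast
  qed
  moreover have "H * H' \<in> forms (n + n')" "eval3 (H * H') P \<noteq> 0"
    using forms_mult[OF H(1) b(3)] H(2) b(4) by (simp_all add: eval3_mult del: eval3.simps)
  ultimately show ?case by blast
qed

text \<open>Some form \<open>E\<close> restricts to 1. Subtracting a multiple of it from a power of
  a linear form produces a zero at \<open>t\<close> and leaves the top coefficient, hence
  nonvanishing at \<open>P\<close>, unchanged.\<close>

lemma form_through_point_off_P:
  obtains l L where "l > 0" "L \<in> forms l" "eval3 L P \<noteq> 0" "poly (\<rho> L) t = 0"
proof -
  obtain N where N: "\<And>j q. degree q \<le> j * D \<Longrightarrow> q \<in> W (N + j)"
    by (rule all_large_in_W) blast
  have "1 \<in> W (Suc N)"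
    using N[of 1 1] by simp
  then obtain E where E: "E \<in> forms (Suc N)" "\<rho> E = 1"
    unfolding W_iff by metis
  obtain L where L: "L \<in> forms 1" "eval3 L P \<noteq> 0"
    by (rule linear_form_off_P)
  define K where "K = L ^ Suc N"
  have K: "K \<in> forms (Suc N)" "eval3 K P \<noteq> 0"
    using forms_power[OF L(1), of "Suc N"] L(2)
    by (simp_all add: K_def eval3_mult eval3_power del: eval3.simps)
  define L' where "L' = K - scale3 (poly (\<rho> K) t) E"
  have L': "L' \<in> forms (Suc N)"
    unfolding L'_def using K(1) E(1) by (intro forms_diff forms_scale)
  have \<rho>L': "\<rho> L' = \<rho> K - [:poly (\<rho> K) t:]"
    by (simp add: L'_def subst3_diff subst3_scale E(2))
  have "coeff (\<rho> L') (Suc N * D) = coeff (\<rho> K) (Suc N * D)"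
    using D_pos by (simp add: \<rho>L' coeff_pCons split: nat.splits)
  then have "eval3 L' P \<noteq> 0"
    using eval3_P_iff[OF L'] eval3_P_iff[OF K(1)] K(2) by simp
  moreover have "poly (\<rho> L') t = 0"
    by (simp add: \<rho>L')
  ultimately show thesis
    using that[of "Suc N" L'] L' by simp
qed

text \<open>Finitely many elements of the local ring can be represented by forms of one degree
  \<open>M\<close> that vanish at a root \<open>t\<close> of \<open>\<rho> G\<close>. Their
  restrictions lie in a proper subspace of \<open>W M\<close>, while
  \<open>\<rho> G * W (M - d)\<close> lies in this subspace and has codimension \<open>d * d\<close>
  in \<open>W M\<close>.\<close>

lemma intersection_number_less:
  assumes G: "G \<in> forms d" "degree (\<rho> G) > 0"
  shows "intersection_number Q C (div_of G) < enat (d * d)"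
proof -
  obtain t where t: "poly (\<rho> G) t = 0"
    using alg_closed_imp_poly_has_root[OF G(2)] by blast
  have G0: "\<rho> G \<noteq> 0" using G(2) by auto
  obtain L0 where L0: "L0 \<in> forms 1" "eval3 L0 P \<noteq> 0"
    by (rule linear_form_off_P)
  \<comment> \<open>A denominator of degree \<open>d\<close> for the local equations of both
    \<open>C\<close> and \<open>G\<close>.\<close>
  define K where "K = L0 ^ d"
  have K: "K \<in> forms d" "\<not> vanishes_at K Q"
    using forms_power[OF L0(1), of d] L0(2)
    by (auto simp: K_def eval3_power vanishes_at_point_of simp del: eval3.simps)
  obtain l L where L: "l > 0" "L \<in> forms l" "eval3 L P \<noteq> 0" "poly (\<rho> L) t = 0"
    by (rule form_through_point_off_P)
  obtain N where N: "\<And>j q. degree q \<le> j * D \<Longrightarrow> q \<in> W (N + j)"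
    by (rule all_large_in_W) blast
  have bound: "card B < d * d" if B: "finite B" "B \<subseteq> local_ring Q"
      "independent_modulo (intersection_ideal Q C (div_of G)) B" for B
  proof -
    obtain n H where H: "H \<in> forms n" "eval3 H P \<noteq> 0" "\<And>b. b \<in> B \<Longrightarrow> \<exists>A\<in>forms n. b = Fract A H"
      using common_denominator[OF B(1,2)] by blast
    \<comment> \<open>A positive power of \<open>L\<close> forces zeros at \<open>t\<close>; this
      exponent also makes \<open>M\<close> large enough for \<open>1 \<in> W M\<close> and for the
      Hilbert function in degree \<open>M - d\<close>.\<close>
    define k where "k = N + 2 * d"
    define M where "M = n + k * l"
    have "k \<le> k * l"
      using L(1) by simp
    then have M: "N + 2 * d \<le> M"
      unfolding M_def by (simp only: k_def trans_le_add2)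
    define H' where "H' = H * L ^ k"
    have H': "H' \<in> forms M" "\<not> vanishes_at H' Q"
      using forms_mult[OF H(1) forms_power[OF L(2), of k]] H(2) L(3) unfolding H'_def M_def
      by (auto simp: vanishes_at_point_of eval3_mult eval3_power simp del: eval3.simps)
    have H'0: "H' \<noteq> 0"
      using not_vanishes_at_Q[OF H'] by blast
    have "\<exists>g. \<forall>b\<in>B. g b \<in> forms M \<and> b = Fract (g b) H' \<and> poly (\<rho> (g b)) t = 0"
    proof (rule bchoice, rule ballI)
      fix b assume "b \<in> B"
      then obtain A where A: "A \<in> forms n" "b = Fract A H"
        using H(3) by blast
      have Lk: "L ^ k \<noteq> 0"
        using H'0 by (auto simp: H'_def)
      have "b = Fract (A * L ^ k) H'"
        by (simp only: H'_def A(2) mult.commute[of _ "L ^ k"] mult_fract_cancel[OF Lk])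
      moreover have "A * L ^ k \<in> forms M"
        unfolding M_def by (intro forms_mult forms_power A L)
      moreover have "poly (\<rho> (A * L ^ k)) t = 0"
        using L(4) d_pos by (simp add: subst3_mult subst3_power k_def)
      ultimately show "\<exists>y. y \<in> forms M \<and> b = Fract y H' \<and> poly (\<rho> y) t = 0" by blast
    qed
    then obtain g where g: "g b \<in> forms M" "b = Fract (g b) H'" "poly (\<rho> (g b)) t = 0" if "b \<in> B" for b
      by metis
    let ?V = "{q \<in> W M. poly q t = 0}" and ?U = "(*) (\<rho> G) ` W (M - d)"
    have V: "polys.subspace ?V"
      by (rule polys.subspaceI) (simp_all add: W_0 W_add W_scale)
    have Wdeg: "W (M - d) \<subseteq> {q. degree q \<le> (M - d) * D}"
      using degree_W by blast
    \<comment> \<open>The constant 1 does not vanish at \<open>t\<close>, so \<open>?V\<close> is a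
      proper subspace; this is the source of the strict inequality.\<close>
    have "1 \<in> W M"
      using N[of 1 "M - N"] M by simp
    then have "polys.dim ?V < polys.dim (W M)"
      by (intro polys.dim_less[OF V _ _ _ W_finite_dim]) auto
    moreover have "polys.dim ?U + card B \<le> polys.dim ?V"
    proof (rule polys.independent_family_modulo[OF B(1) _ _ _ V])
      show "polys.subspace ?U"
        by (rule dim_mult_polys(1)[OF G0 subspace_W Wdeg])
      have "\<rho> G \<in> W d"
        using G(1) by (auto simp: W_def)
      then show "?U \<subseteq> ?V"
        using W_mult[of "\<rho> G" d _ "M - d"] M t by auto
      show "(\<lambda>b. \<rho> (g b)) ` B \<subseteq> ?V"
        using g by (auto simp: W_def)
      show "?V \<subseteq> polys.span ((\<lambda>i. monom 1 i) ` {..M * D})"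
        using W_finite_dim by blast
      fix c
      assume "(\<Sum>b\<in>B. smult (c b) (\<rho> (g b))) \<in> ?U"
      then obtain A where A: "A \<in> forms (M - d)" "(\<Sum>b\<in>B. smult (c b) (\<rho> (g b))) = \<rho> G * \<rho> A"
        by (auto simp: W_def)
      \<comment> \<open>A relation modulo \<open>\<rho> G * W (M - d)\<close> lifts to forms:
        \<open>S - G * A\<close> restricts to 0, hence is a multiple of \<open>F\<close>, and the
        combination of local ring elements falls into the intersection ideal.\<close>
      define S where "S = (\<Sum>b\<in>B. scale3 (c b) (g b))"
      have S: "S \<in> forms M"
        unfolding S_def using g(1) by (intro forms_sum forms_scale) auto
      have GA: "G * A \<in> forms M"
        using forms_mult[OF G(1) A(1)] M by simp
      have diff: "S - G * A \<in> forms M"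
        using S GA by (rule forms_diff)
      moreover have "\<rho> (S - G * A) = 0"
        using A(2) by (simp add: S_def subst3_diff subst3_sum subst3_scale subst3_mult)
      ultimately have "F dvd S - G * A"
        by (rule F_dvd)
      then obtain E where E: "S - G * A = F * E" by (rule dvdE)
      have "E \<in> forms (M - d)"
        using form_cofactor[OF F_form F_nonzero, of E M] diff F_nonzero forms_0[of "M - d"]
        unfolding E by (cases "E = 0") auto
      then have EK: "E * K \<in> forms M" "A * K \<in> forms M"
        using forms_mult[OF _ K(1), of _ "M - d"] A(1) M by auto
      have K0: "K \<noteq> 0"
        using not_vanishes_at_Q[OF K] by blast
      have "(\<Sum>b\<in>B. Fract (const3 (c b)) 1 * b) = (\<Sum>b\<in>B. Fract (const3 (c b)) 1 * Fract (g b) H')"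
        using g(2) by (intro sum.cong) auto
      also have "\<dots> = Fract S H'"
        unfolding S_def by (rule sum_Fract[OF H'0])
      also have "S = F * E + G * A"
        using E by (simp add: algebra_simps)
      also have "Fract (F * E + G * A) H' = Fract (E * K) H' * Fract F K + Fract (A * K) H' * Fract G K"
      proof -
        have "Fract (E * K) H' * Fract F K = Fract (K * (F * E)) (K * H')"
          "Fract (A * K) H' * Fract G K = Fract (K * (G * A)) (K * H')"
          by (simp_all only: mult_fract mult_ac)
        then show ?thesis
          unfolding mult_fract_cancel[OF K0] by (simp only: Fract_add_same[OF H'0])
      qed
      also have "\<dots> \<in> intersection_ideal Q C (div_of G)"
      proof -
        have "Fract (E * K) H' \<in> local_ring Q" "Fract (A * K) H' \<in> local_ring Q"
          unfolding local_ring_def using EK H' by blast+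
        moreover have "Fract F K \<in> local_equations Q C" "Fract G K \<in> local_equations Q (div_of G)"
          unfolding local_equations_def using self_in_div_of F_form G(1) K by blast+
        ultimately show ?thesis
          unfolding intersection_ideal_def by blast
      qed
      finally show "\<forall>b\<in>B. c b = 0"
        using B(3) unfolding independent_modulo_def by blast
    qed simp
    moreover have "polys.dim ?U = card (T (M - d))"
      using dim_mult_polys(2)[OF G0 subspace_W Wdeg] dim_W by simp
    ultimately have "card (T (M - d)) + card B < card (T M)"
      using dim_W[of M] by simp
    moreover have "card (T (M - d)) + \<delta> = (M - d) * d + 1" "card (T M) + \<delta> = M * d + 1"
      using card_T[of "M - d - d"] card_T[of "M - d"] M by simp_all
    moreover have "M * d = (M - d) * d + d * d"
      using M by (simp add: diff_mult_distrib)
    ultimately show ?thesis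
      by linarith
  qed
  \<comment> \<open>Stating the bound as \<open>d * d - 1\<close> keeps it strict when passing to
    the supremum.\<close>
  have "intersection_number Q C (div_of G) \<le> enat (d * d - 1)"
    unfolding intersection_number_def
  proof (rule Sup_least)
    fix x
    assume "x \<in> {enat (card B) | B. finite B \<and> B \<subseteq> local_ring Q \<and>
        independent_modulo (intersection_ideal Q C (div_of G)) B}"
    then obtain B where B: "x = enat (card B)" "finite B" "B \<subseteq> local_ring Q"
        "independent_modulo (intersection_ideal Q C (div_of G)) B" by blast
    then show "x \<le> enat (d * d - 1)"
      using bound[OF B(2-4)] by simp
  qed
  also have "\<dots> < enat (d * d)"
    using d_pos by simp
  finally show ?thesis .
qed

section \<open>The pencil, its base locus and its uniqueness\<close>

definition pencil_forms :: "'a poly3 set" where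
  "pencil_forms = {G \<in> forms d. degree (\<rho> G) = 0}"

lemma subspace_pencil_forms: "forms3.subspace pencil_forms"
proof (rule forms3.subspaceI)
  fix x y assume "x \<in> pencil_forms" "y \<in> pencil_forms"
  then show "x + y \<in> pencil_forms"
    using degree_add_le[of "\<rho> x" 0 "\<rho> y"] by (simp add: pencil_forms_def forms_add subst3_add)
qed (simp_all add: pencil_forms_def forms_0 forms_scale subst3_scale)

lemma pencil_forms_finite_dim:
  "pencil_forms \<subseteq> forms3.span ((\<lambda>(i, j, k). monom3 1 i j k) ` degree_triples d)"
  using forms_span by (auto simp: pencil_forms_def)

text \<open>The restrictions are the constants, all of them by \<open>form_meeting_only_P\<close>,
  which gives one dimension; the kernel consists of the scalar multiples of \<open>F\<close> and
  gives the other.\<close>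

lemma dim_pencil_forms: "forms3.dim pencil_forms = 2"
proof -
  obtain G c where G: "G \<in> forms d" "c \<noteq> 0" "\<rho> G = [:c:]"
    by (rule form_meeting_only_P)
  have "{degree (\<rho> x) | x. x \<in> pencil_forms \<and> \<rho> x \<noteq> 0} = {0}"
  proof
    show "{0} \<subseteq> {degree (\<rho> x) | x. x \<in> pencil_forms \<and> \<rho> x \<noteq> 0}"
      using G by (auto simp: pencil_forms_def intro!: exI[of _ G])
  qed (auto simp: pencil_forms_def)
  moreover have "{x \<in> pencil_forms. \<rho> x = 0} = kernel (0 + d)"
    by (auto simp: pencil_forms_def kernel_def)
  ultimately show ?thesis
    using forms3.dim_eq_card_degrees(2)[OF subspace_pencil_forms pencil_forms_finite_dim
        finite_forms_spanning, of \<rho>] card_degree_triples[of 0]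
    by (simp add: subst3_add subst3_scale kernel_eq[of 0, simplified] dim_mult_forms[OF F_nonzero])
qed

lemma divisor_degree_C: "divisor_degree C = d"
  by (rule divisor_degree_div_of[OF F_form F_nonzero])

lemma assoc_pencil_eq: "assoc_pencil C Q = div_of ` (pencil_forms - {0})"
proof (intro equalityI subsetI)
  fix E assume "E \<in> assoc_pencil C Q"
  then obtain G where G: "G \<in> forms d" "G \<noteq> 0" "E = div_of G"
      "intersection_number Q C (div_of G) \<ge> enat (d * d)"
    unfolding assoc_pencil_def divisor_degree_C effective_divisors_def by (auto simp: power2_eq_square)
  then have "degree (\<rho> G) = 0"
    using intersection_number_less[OF G(1)] by (cases "degree (\<rho> G) > 0") auto
  then show "E \<in> div_of ` (pencil_forms - {0})"
    using G by (auto simp: pencil_forms_def)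
next
  fix E assume "E \<in> div_of ` (pencil_forms - {0})"
  then obtain G where G: "G \<in> forms d" "G \<noteq> 0" "E = div_of G" "degree (\<rho> G) = 0"
    by (auto simp: pencil_forms_def)
  then obtain e where "\<rho> G = [:e:]"
    by (auto elim: degree_eq_zeroE)
  then show "E \<in> assoc_pencil C Q"
    unfolding assoc_pencil_def divisor_degree_C effective_divisors_def
    using G intersection_number_ge[OF G(1,2)] by (auto simp: power2_eq_square)
qed

lemma F_in_pencil_forms: "F \<in> pencil_forms"
  by (simp add: pencil_forms_def F_form)

lemma affine_point_neq_Q: "point_of (triple_at \<phi> t) \<noteq> Q"
proof
  assume "point_of (triple_at \<phi> t) = Q"
  then have "P \<in> point_of (triple_at \<phi> t)"
    using in_point_of by blast
  then obtain c where "P = mult_triple c (triple_at \<phi> t)"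
    by (auto simp: point_of_def)
  then show False
    using lead_eq_P lead_not_on_affine_part by (auto simp: mult_triple_mult)
qed

text \<open>Base points lie on the curve because \<open>F\<close> belongs to the pencil. A member
  with nonzero constant restriction excludes the affine points, and a constant has no coefficient at
  \<open>d * D > 0\<close>, so all members pass through \<open>P\<close>.\<close>

lemma base_locus_assoc_pencil: "base_locus (assoc_pencil C Q) = {Q}"
proof (intro equalityI subsetI)
  fix p assume "p \<in> base_locus (assoc_pencil C Q)"
  then have p: "p \<in> proj_plane" "\<And>G. G \<in> pencil_forms \<Longrightarrow> G \<noteq> 0 \<Longrightarrow> p \<in> supp (div_of G)"
    unfolding base_locus_def assoc_pencil_eq by auto
  then obtain v where v: "p = point_of v" "v \<noteq> (0, 0, 0)"
    by (auto simp: proj_plane_eq)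
  have ev: "eval3 G v = 0" if "G \<in> pencil_forms" for G
  proof (cases "G = 0")
    case False
    then have "point_of v \<in> supp (div_of G)" "G \<in> forms d"
      using p(2)[OF that] v that by (auto simp: pencil_forms_def)
    then show ?thesis
      using point_of_in_supp by blast
  qed (simp del: eval3.simps)
  obtain G c where G: "G \<in> forms d" "c \<noteq> 0" "\<rho> G = [:c:]"
    by (rule form_meeting_only_P)
  have "v \<noteq> mult_triple b (triple_at \<phi> t)" for b t
  proof
    assume b: "v = mult_triple b (triple_at \<phi> t)"
    then have "b \<noteq> 0" using v(2) by (auto simp: mult_triple_0)
    have "eval3 G v = 0"
      using ev G by (simp add: pencil_forms_def)
    then have "poly (\<rho> G) t = 0"
      using \<open>b \<noteq> 0\<close> unfolding b eval3_mult_triple[OF G(1)] poly_subst3_triple by simp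
    then show False
      using G by simp
  qed
  then obtain b where b: "v = mult_triple b P"
    using curve_points[OF v(2) ev[OF F_in_pencil_forms]] by blast
  then have "b \<noteq> 0" using v(2) by (auto simp: mult_triple_0)
  then show "p \<in> {Q}"
    by (simp add: v(1) b point_of_mult_triple)
next
  fix p assume "p \<in> {Q}"
  then have p: "p = Q" "Q \<in> proj_plane"
    using P_nonzero by (auto simp: proj_plane_eq)
  have "Q \<in> supp (div_of G)" if "G \<in> pencil_forms" for G
  proof -
    have G: "G \<in> forms d" "degree (\<rho> G) = 0"
      using that by (auto simp: pencil_forms_def)
    have "coeff (\<rho> G) (d * D) = 0"
      using G(2) d_pos D_pos by (simp add: coeff_eq_0)
    then show ?thesis
      using eval3_P_iff[OF G(1)] p(2) point_of_in_supp[OF G(1)] by blast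
  qed
  then show "p \<in> base_locus (assoc_pencil C Q)"
    using p unfolding base_locus_def assoc_pencil_eq by auto
qed

text \<open>A root \<open>t\<close> of \<open>\<rho> G\<close> for some \<open>G\<close> in
  \<open>V\<close> would be a base point other than \<open>P\<close>. So all restrictions are
  constant, \<open>V\<close> lies in \<open>pencil_forms\<close>, and both have dimension 2.\<close>

lemma pencil_unique:
  assumes "pencil \<Lambda>" "C \<in> \<Lambda>" "base_locus \<Lambda> = {Q}"
  shows "\<Lambda> = assoc_pencil C Q"
proof -
  obtain n V where V: "V \<subseteq> forms n" "forms3.subspace V" "forms3.dim V = 2" "\<Lambda> = div_of ` (V - {0})"
    using assms(1) unfolding pencil_def linear_system_def by auto
  obtain G' where G': "G' \<in> V" "C = div_of G'"
    using assms(2) unfolding V(4) by blast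
  have "F \<in> div_of G'"
    using self_in_div_of[of F] G'(2) by simp
  then have FV: "F \<in> V"
    using forms3.subspace_scale[OF V(2) G'(1)] by (auto simp: div_of_def)
  then have n: "n = d"
    using forms_degree_unique[OF F_form _ F_nonzero] V(1) by blast
  have Vfin: "V \<subseteq> forms3.span ((\<lambda>(i, j, k). monom3 1 i j k) ` degree_triples d)"
    using V(1) forms_span unfolding n by blast
  have "degree (\<rho> G) = 0" if GV: "G \<in> V" for G
  proof (rule ccontr)
    assume "degree (\<rho> G) \<noteq> 0"
    then obtain t where t: "poly (\<rho> G) t = 0"
      using alg_closed_imp_poly_has_root[of "\<rho> G"] by auto
    define U where "U = {H \<in> V. eval3 H (triple_at \<phi> t) = 0}"
    have U: "forms3.subspace U"
      unfolding U_def using forms3.subspace_0[OF V(2)] forms3.subspace_add[OF V(2)] forms3.subspace_scale[OF V(2)]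
      by (intro forms3.subspaceI) (simp_all add: eval3_add eval3_scale del: eval3.simps)
    have FG: "F \<in> U" "G \<in> U"
      using FV GV F_\<phi> t by (simp_all add: U_def poly_subst3_triple del: eval3.simps)
    \<comment> \<open>\<open>F\<close> and \<open>G\<close> are independent, since
      \<open>\<rho> G\<close> is not zero; so they already span the two-dimensional
      \<open>V\<close>.\<close>
    have "V \<subseteq> U"
    proof (rule ccontr)
      assume "\<not> V \<subseteq> U"
      then have "forms3.dim U < 2"
        using forms3.dim_less[OF U _ _ _ Vfin finite_forms_spanning] V(3) by (auto simp: U_def)
      moreover have "G \<notin> forms3.span {F}"
      proof
        assume "G \<in> forms3.span {F}"
        then obtain c where "G = scale3 c F"
          by (auto simp: forms3.span_singleton)
        then show False
          using \<open>degree (\<rho> G) \<noteq> 0\<close> by (simp add: subst3_scale)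
      qed
      then have "forms3.dim (forms3.span {F}) < forms3.dim U"
        using FG U Vfin
        by (intro forms3.dim_less[OF forms3.subspace_span forms3.span_minimal _ _ _ finite_forms_spanning])
           (auto simp: U_def)
      moreover have "forms3.dim (forms3.span {F}) = 1"
        using F_nonzero by (subst forms3.dim_span_eq_card_independent) auto
      ultimately show False by simp
    qed
    then have "point_of (triple_at \<phi> t) \<in> base_locus \<Lambda>"
      unfolding base_locus_def V(4) using V(1) \<phi>_nonzero[of t]
      by (auto simp: proj_plane_eq U_def intro!: point_of_in_supp[THEN iffD2])
    then show False
      using assms(3) affine_point_neq_Q by blast
  qed
  then have "V \<subseteq> pencil_forms"
    using V(1) unfolding n pencil_forms_def by blast
  have "x \<in> V" if "x \<in> pencil_forms" for x
  proof (rule ccontr)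
    assume "x \<notin> V"
    then have "forms3.dim V < forms3.dim pencil_forms"
      by (rule forms3.dim_less[OF V(2) \<open>V \<subseteq> pencil_forms\<close> that _ pencil_forms_finite_dim finite_forms_spanning])
    then show False
      by (simp only: V(3) dim_pencil_forms less_irrefl)
  qed
  with \<open>V \<subseteq> pencil_forms\<close> have "V = pencil_forms"
    by blast
  then show ?thesis
    by (simp add: V(4) assoc_pencil_eq)
qed

theorem unique_pencil:
  "pencil (assoc_pencil C Q) \<and> C \<in> assoc_pencil C Q \<and> base_locus (assoc_pencil C Q) = {Q} \<and>
    (\<forall>\<Lambda>. pencil \<Lambda> \<and> C \<in> \<Lambda> \<and> base_locus \<Lambda> = {Q} \<longrightarrow> \<Lambda> = assoc_pencil C Q)"
proof (intro conjI allI impI)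
  have "pencil_forms \<subseteq> forms d"
    by (auto simp: pencil_forms_def)
  then show "pencil (assoc_pencil C Q)"
    unfolding pencil_def linear_system_def assoc_pencil_eq
    using subspace_pencil_forms dim_pencil_forms by (intro exI[of _ d] exI[of _ pencil_forms]) auto
  show "C \<in> assoc_pencil C Q"
    unfolding assoc_pencil_eq using F_in_pencil_forms F_nonzero by blast
  show "base_locus (assoc_pencil C Q) = {Q}"
    by (rule base_locus_assoc_pencil)
  show "\<Lambda> = assoc_pencil C Q" if "pencil \<Lambda> \<and> C \<in> \<Lambda> \<and> base_locus \<Lambda> = {Q}" for \<Lambda>
    using that by (intro pencil_unique) auto
qed

end

subsection \<open>From the affine line to a parametrization\<close>

text \<open>A nonzero polynomial has finitely many roots, and being empty or cofinite survives
  finite intersections and arbitrary unions.\<close>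

lemma openin_zariski_line_cofinite:
  assumes "openin zariski_line V" "V \<noteq> {}"
  shows "finite (- V)"
proof -
  have "generate_topology_on {{t. poly h t \<noteq> 0} | h. True} V"
    using assms(1) unfolding zariski_line_def openin_topology_generated_by_iff .
  then have "V = {} \<or> finite (- V)"
  proof (induction rule: generate_topology_on.induct)
    case (Basis U)
    then obtain h where h: "U = {t. poly h t \<noteq> 0}" by blast
    show ?case
    proof (cases "h = 0")
      case False
      then show ?thesis
        using poly_roots_finite[of h] by (simp add: h Compl_eq)
    qed (simp add: h)
  next
    case (Int U W)
    then show ?case by auto
  next
    case (UN K)
    show ?case
    proof (cases "\<Union>K = {}")
      case False
      then obtain U where "U \<in> K" "U \<noteq> {}" by blast
      then have "finite (- U)" "- \<Union>K \<subseteq> - U"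
        using UN by auto
      then show ?thesis
        using finite_subset by blast
    qed simp
  qed simp
  then show ?thesis using assms(2) by blast
qed

lemma topspace_zariski_line: "topspace zariski_line = UNIV"
proof -
  have "UNIV = {t. poly 1 t \<noteq> (0::'a)}" by simp
  then have "UNIV \<in> {{t. poly h t \<noteq> (0::'a)} | h. True}" by blast
  then show ?thesis
    unfolding zariski_line_def topology_generated_by_topspace by blast
qed

lemma poly_eqI_cofinite:
  fixes p q :: "'a::field_char_0 poly"
  assumes "finite (- V)" "\<And>t. t \<in> V \<Longrightarrow> poly p t = poly q t"
  shows "p = q"
proof (rule ccontr)
  assume "p \<noteq> q"
  then have "finite {t. poly (p - q) t = 0}"
    by (intro poly_roots_finite) simp
  moreover have "V \<subseteq> {t. poly (p - q) t = 0}"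
    using assms(2) by auto
  ultimately have "finite (V \<union> - V)"
    using assms(1) finite_subset by blast
  then show False
    by (simp add: infinite_UNIV_char_0)
qed

section \<open>Coordinates of points and proportional triples\<close>

lemma point_of_cases:
  assumes "p \<in> proj_plane"
  obtains v where "p = point_of v" "v \<noteq> (0, 0, 0)"
  using assms by (auto simp: proj_plane_eq)

lemma point_of_eqI:
  assumes "v \<in> point_of w"
  shows "point_of v = point_of w"
proof -
  obtain c where c: "c \<noteq> 0" "v = mult_triple c w"
    using assms unfolding point_of_def by blast
  show ?thesis
    unfolding c(2) by (rule point_of_mult_triple[OF c(1)])
qed

lemma in_proj_plane_eq:
  assumes "p \<in> proj_plane" "v \<in> p"
  shows "p = point_of v \<and> v \<noteq> (0, 0, 0)"
proof -
  obtain w where w: "p = point_of w" "w \<noteq> (0, 0, 0)"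
    using assms(1) by (rule point_of_cases)
  then obtain c where "c \<noteq> 0" "v = mult_triple c w"
    using assms(2) unfolding point_of_def by blast
  then have "v \<noteq> (0, 0, 0)"
    using w(2) by (cases w) auto
  then show ?thesis
    using point_of_eqI[of v w] assms(2) w(1) by simp
qed

text \<open>Linear factors at common roots are split off one at a time; the sum of the degrees
  decreases because one component is nonzero.\<close>

lemma divide_common_factor:
  fixes a b c :: "'a::field poly"
  assumes "(a, b, c) \<noteq> (0, 0, 0)"
  shows "\<exists>g x y z. g \<noteq> 0 \<and> a = g * x \<and> b = g * y \<and> c = g * z \<and>
    (\<forall>t. triple_at (x, y, z) t \<noteq> (0, 0, 0))"
  using assms
proof (induction "degree a + degree b + degree c" arbitrary: a b c rule: less_induct)
  case less
  show ?case
  proof (cases "\<exists>t. poly a t = 0 \<and> poly b t = 0 \<and> poly c t = 0")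
    case False
    then show ?thesis
      by (intro exI[of _ 1] exI[of _ a] exI[of _ b] exI[of _ c]) auto
  next
    case True
    then obtain t where "poly a t = 0" "poly b t = 0" "poly c t = 0" by blast
    then obtain a' b' c' where abc: "a = [:- t, 1:] * a'" "b = [:- t, 1:] * b'" "c = [:- t, 1:] * c'"
      by (metis dvdE poly_eq_0_iff_dvd)
    have le: "degree p \<le> degree ([:- t, 1:] * p)" "p \<noteq> 0 \<Longrightarrow> degree p < degree ([:- t, 1:] * p)"
      for p :: "'a poly"
      by (cases "p = 0"; simp add: degree_mult_eq del: mult_pCons_left)+
    have "(a', b', c') \<noteq> (0, 0, 0)"
      using less.prems abc by auto
    moreover from this have "degree a' + degree b' + degree c' < degree a + degree b + degree c"
      using le(1)[of a'] le(1)[of b'] le(1)[of c'] le(2)[of a'] le(2)[of b'] le(2)[of c']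
      unfolding abc by (auto simp del: mult_pCons_left)
    ultimately obtain g x y z where g: "g \<noteq> 0" "a' = g * x" "b' = g * y" "c' = g * z"
        "\<forall>t. triple_at (x, y, z) t \<noteq> (0, 0, 0)"
      using less.hyps by metis
    have "[:- t, 1:] * g \<noteq> 0" "a = ([:- t, 1:] * g) * x" "b = ([:- t, 1:] * g) * y" "c = ([:- t, 1:] * g) * z"
      unfolding abc g(2-4) using g(1) by (simp_all only: mult.assoc mult_eq_0_iff) auto
    with g(5) show ?thesis by blast
  qed
qed

text \<open>The three equations say that the 2 by 2 minors vanish; the factor is found at a nonzero
  coordinate of the second triple.\<close>

lemma proportional_triple:
  fixes x y z a b c :: "'a::field"
  assumes "(x, y, z) \<noteq> (0, 0, 0)" "(a, b, c) \<noteq> (0, 0, 0)"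
    and "x * b = y * a" "x * c = z * a" "y * c = z * b"
  shows "(x, y, z) \<in> point_of (a, b, c)"
proof -
  have "\<exists>k. x = k * a \<and> y = k * b \<and> z = k * c"
  proof -
    consider "a \<noteq> 0" | "b \<noteq> 0" | "c \<noteq> 0" using assms(2) by auto
    then show ?thesis
    proof cases
      case 1
      then show ?thesis using assms(3,4) by (intro exI[of _ "x / a"]) (simp add: field_simps)
    next
      case 2
      then show ?thesis using assms(3,5) by (intro exI[of _ "y / b"]) (simp add: field_simps)
    next
      case 3
      then show ?thesis using assms(4,5) by (intro exI[of _ "z / c"]) (simp add: field_simps)
    qed
  qed
  then obtain k where "(x, y, z) = mult_triple k (a, b, c)" by auto
  moreover from this have "k \<noteq> 0" using assms(1) by auto
  ultimately show ?thesis unfolding point_of_def by blast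
qed

lemma supp_subset: "supp E \<subseteq> proj_plane"
  by (auto simp: supp_def)

text \<open>A ratio of two coordinates is a regular function where the denominator does not vanish;
  pulling it back shows that a morphism from the line is locally given by polynomials.\<close>

lemma morphism_locally_polynomial:
  fixes \<phi> :: "'a::field_char_0 \<Rightarrow> 'a point"
  assumes \<phi>: "morphism zariski_line regular_line (subtopology zariski_plane Y) regular_plane \<phi>"
    and Y: "Y \<subseteq> proj_plane"
  shows "\<exists>v V. finite (- V) \<and> t0 \<in> V \<and> (\<forall>t\<in>V. triple_at v t \<in> \<phi> t)"
proof -
  have cont: "continuous_map zariski_line (subtopology zariski_plane Y) \<phi>"
    using \<phi> by (simp add: morphism_def)
  have top: "topspace (subtopology zariski_plane Y) = Y"
    using Y by (auto simp: topspace_zariski_plane)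
  have \<phi>Y: "\<phi> t \<in> Y" for t
    using continuous_map_funspace[OF cont] by (auto simp: topspace_zariski_line top)
  \<comment> \<open>The coordinate functions \<open>X\<close>, \<open>Y\<close>, \<open>Z\<close>,
    indexed so that the one not vanishing at the given point can be chosen uniformly.\<close>
  define e :: "nat \<Rightarrow> 'a poly3" where "e k = [linear_form 1 0 0, linear_form 0 1 0, linear_form 0 0 1] ! k" for k
  have e: "e k \<in> forms 1" if "k < 3" for k
    using that linear_form_in_forms by (auto simp: e_def less_Suc_eq numeral_3_eq_3)
  have e_eval: "(eval3 (e 0) v, eval3 (e 1) v, eval3 (e 2) v) = v" for v
    by (cases v) (simp add: e_def eval3_linear_form del: eval3.simps)
  obtain v0 where v0: "\<phi> t0 = point_of v0" "v0 \<noteq> (0, 0, 0)"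
    using point_of_cases \<phi>Y Y by blast
  obtain i where i: "i < 3" "eval3 (e i) v0 \<noteq> 0"
  proof -
    have "eval3 (e 0) v0 \<noteq> 0 \<or> eval3 (e 1) v0 \<noteq> 0 \<or> eval3 (e 2) v0 \<noteq> 0"
      using e_eval[of v0] v0(2) by metis
    then show thesis
      using that[of 0] that[of 1] that[of 2] by linarith
  qed
  define U where "U = {p \<in> Y. \<not> vanishes_at (e i) p}"
  have "openin zariski_plane {p \<in> proj_plane. \<not> vanishes_at (e i) p}"
    unfolding zariski_plane_def using e[OF i(1)] by (intro topology_generated_by_Basis) blast
  moreover have "U = {p \<in> proj_plane. \<not> vanishes_at (e i) p} \<inter> Y"
    using Y by (auto simp: U_def)
  ultimately have openU: "openin (subtopology zariski_plane Y) U"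
    unfolding openin_subtopology by blast
  define U' where "U' = {t. \<phi> t \<in> U}"
  have openU': "openin zariski_line U'"
    using openin_continuous_map_preimage[OF cont openU] by (simp add: U'_def topspace_zariski_line)
  have t0: "t0 \<in> U'"
    using \<phi>Y i(2) vanishes_at_point_of[OF e[OF i(1)]] by (auto simp: U'_def U_def v0(1))
  \<comment> \<open>The choice of a representative is harmless: numerator and denominator scale by
    the same factor.\<close>
  define f where "f k p = eval3 (e k) (SOME w. w \<in> p) / eval3 (e i) (SOME w. w \<in> p)" for k p
  have f: "eval3 (e i) v \<noteq> 0 \<and> f k p = eval3 (e k) v / eval3 (e i) v"
    if "p \<in> U" "v \<in> p" "k < 3" for k p v
  proof -
    have "p \<in> proj_plane" using that(1) Y by (auto simp: U_def)
    then have p: "p = point_of v"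
      using in_proj_plane_eq that(2) by blast
    then have ne: "eval3 (e i) v \<noteq> 0"
      using that(1) vanishes_at_point_of[OF e[OF i(1)]] by (auto simp: U_def)
    have "(SOME w. w \<in> p) \<in> p"
      using that(2) by (rule someI)
    then obtain c where c: "c \<noteq> 0" "(SOME w. w \<in> p) = mult_triple c v"
      unfolding p point_of_def by blast
    show ?thesis
      unfolding f_def c(2) eval3_mult_triple[OF e[OF that(3)]] eval3_mult_triple[OF e[OF i(1)]]
      using c(1) ne by simp
  qed
  have local: "\<exists>V g h. finite (- V) \<and> t0 \<in> V \<and> V \<subseteq> U' \<and> (\<forall>s\<in>V. poly h s \<noteq> 0 \<and> f k (\<phi> s) = poly g s / poly h s)"
    if k: "k < 3" for k
  proof -
    have "regular_plane U (f k)"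
      unfolding regular_plane_def
    proof
      fix p assume p: "p \<in> U"
      have "U \<subseteq> topspace zariski_plane"
        using Y unfolding topspace_zariski_plane U_def by blast
      then have "openin (subtopology zariski_plane U) U"
        by (simp only: openin_subtopology_refl)
      moreover have "\<forall>q\<in>U. \<forall>v\<in>q. eval3 (e i) v \<noteq> 0 \<and> f k q = eval3 (e k) v / eval3 (e i) v"
        using f k by blast
      ultimately show "\<exists>V. openin (subtopology zariski_plane U) V \<and> p \<in> V \<and>
          (\<exists>n. \<exists>G\<in>forms n. \<exists>H\<in>forms n. \<forall>q\<in>V. \<forall>v\<in>q. eval3 H v \<noteq> 0 \<and> f k q = eval3 G v / eval3 H v)"
        using p e[OF k] e[OF i(1)] by blast
    qed
    then have "regular_line {x \<in> topspace zariski_line. \<phi> x \<in> U} (f k \<circ> \<phi>)"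
      using openU by (intro conjunct2[OF \<phi>[unfolded morphism_def], rule_format] conjI)
    then have "regular_line U' (f k \<circ> \<phi>)"
      by (simp add: U'_def topspace_zariski_line)
    from bspec[OF this[unfolded regular_line_def] t0]
    obtain V g h where V: "openin (subtopology zariski_line U') V" "t0 \<in> V"
        "\<forall>s\<in>V. poly h s \<noteq> 0 \<and> (f k \<circ> \<phi>) s = poly g s / poly h s"
      by (elim exE conjE) (rule that)
    have "openin zariski_line V" "V \<subseteq> U'"
      using V(1) openU' openin_trans_full openin_imp_subset by blast+
    then show ?thesis
      using V openin_zariski_line_cofinite[of V] by auto
  qed
  obtain V0 g0 h0 where V0: "finite (- V0)" "t0 \<in> V0" "V0 \<subseteq> U'"
      "\<forall>s\<in>V0. poly h0 s \<noteq> 0 \<and> f 0 (\<phi> s) = poly g0 s / poly h0 s"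
    using local[of 0] by auto
  obtain V1 g1 h1 where V1: "finite (- V1)" "t0 \<in> V1" "V1 \<subseteq> U'"
      "\<forall>s\<in>V1. poly h1 s \<noteq> 0 \<and> f 1 (\<phi> s) = poly g1 s / poly h1 s"
    using local[of 1] by auto
  obtain V2 g2 h2 where V2: "finite (- V2)" "t0 \<in> V2" "V2 \<subseteq> U'"
      "\<forall>s\<in>V2. poly h2 s \<noteq> 0 \<and> f 2 (\<phi> s) = poly g2 s / poly h2 s"
    using local[of 2] by auto
  \<comment> \<open>Multiplying the three ratios by \<open>h0 * h1 * h2\<close> clears all
    denominators and only rescales the point.\<close>
  have "triple_at (g0 * h1 * h2, g1 * h0 * h2, g2 * h0 * h1) t \<in> \<phi> t" if t: "t \<in> V0 \<inter> V1 \<inter> V2" for t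
  proof -
    obtain w where w: "\<phi> t = point_of w" "w \<noteq> (0, 0, 0)"
      using point_of_cases \<phi>Y Y by blast
    have U: "\<phi> t \<in> U" using t V0(3) by (auto simp: U'_def)
    have w_in: "w \<in> \<phi> t" using in_point_of w(1) by blast
    define E where "E k = eval3 (e k) w" for k
    have fE: "E i \<noteq> 0" "f 0 (\<phi> t) = E 0 / E i" "f 1 (\<phi> t) = E 1 / E i" "f 2 (\<phi> t) = E 2 / E i"
      using f[OF U w_in, of 0] f[OF U w_in, of 1] f[OF U w_in, of 2] by (simp_all only: E_def) simp_all
    have wE: "w = (E 0, E 1, E 2)"
      unfolding E_def by (rule e_eval[symmetric])
    have h: "poly h0 t \<noteq> 0" "poly h1 t \<noteq> 0" "poly h2 t \<noteq> 0"
      using V0(4) V1(4) V2(4) t by blast+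
    have g: "poly g0 t = E 0 / E i * poly h0 t" "poly g1 t = E 1 / E i * poly h1 t" "poly g2 t = E 2 / E i * poly h2 t"
      using V0(4) V1(4) V2(4) t fE(2-4) by (metis IntE nonzero_eq_divide_eq)+
    have "triple_at (g0 * h1 * h2, g1 * h0 * h2, g2 * h0 * h1) t =
        mult_triple (poly h0 t * poly h1 t * poly h2 t / E i) w"
      unfolding wE by (simp add: g)
    moreover have "poly h0 t * poly h1 t * poly h2 t / E i \<noteq> 0"
      using h fE(1) by simp
    ultimately show ?thesis
      unfolding w(1) point_of_def by blast
  qed
  moreover have "finite (- (V0 \<inter> V1 \<inter> V2))"
    using V0(1) V1(1) V2(1) by (simp add: Compl_Int)
  ultimately show ?thesis
    using V0(2) V1(2) V2(2) by (intro exI conjI ballI) (assumption | blast)+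
qed

text \<open>The local description near 0, freed of common roots, is valid everywhere: near any other
  parameter it is compared with the local description there.\<close>

lemma morphism_polynomial:
  fixes \<phi> :: "'a::field_char_0 \<Rightarrow> 'a point"
  assumes \<phi>: "morphism zariski_line regular_line (subtopology zariski_plane Y) regular_plane \<phi>"
    and Y: "Y \<subseteq> proj_plane"
  obtains v where "\<And>t. triple_at v t \<noteq> (0, 0, 0)" "\<And>t. \<phi> t = point_of (triple_at v t)"
proof -
  have \<phi>Y: "\<phi> t \<in> proj_plane" for t
    using \<phi> Y continuous_map_funspace[of zariski_line "subtopology zariski_plane Y" \<phi>]
    by (auto simp: morphism_def topspace_zariski_line)
  obtain v0 V0 where v0: "finite (- V0)" "0 \<in> V0" "\<And>t. t \<in> V0 \<Longrightarrow> triple_at v0 t \<in> \<phi> t"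
    using morphism_locally_polynomial[OF \<phi> Y, of 0] by blast
  obtain a0 b0 c0 where abc0: "v0 = (a0, b0, c0)" by (cases v0)
  have "triple_at v0 0 \<noteq> (0, 0, 0)"
    using in_proj_plane_eq[OF \<phi>Y v0(3)[OF v0(2)]] by blast
  then have "(a0, b0, c0) \<noteq> (0, 0, 0)"
    by (auto simp: abc0)
  then obtain g x y z where g: "g \<noteq> 0" "a0 = g * x" "b0 = g * y" "c0 = g * z"
      and xyz: "\<forall>t. triple_at (x, y, z) t \<noteq> (0, 0, 0)"
    using divide_common_factor by metis
  have "\<phi> t = point_of (triple_at (x, y, z) t)" for t
  proof -
    obtain v V where v: "finite (- V)" "t \<in> V" "\<And>s. s \<in> V \<Longrightarrow> triple_at v s \<in> \<phi> s"
      using morphism_locally_polynomial[OF \<phi> Y, of t] by blast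
    obtain a b c where abc: "v = (a, b, c)" by (cases v)
    define V' where "V' = V \<inter> V0 \<inter> {s. poly g s \<noteq> 0}"
    have "- {s. poly g s \<noteq> 0} = {s. poly g s = 0}" by auto
    then have fin: "finite (- V')"
      using v(1) v0(1) poly_roots_finite[OF g(1)] by (simp add: V'_def Compl_Int)
    have cross: "poly x s * poly b s = poly y s * poly a s" "poly x s * poly c s = poly z s * poly a s"
      "poly y s * poly c s = poly z s * poly b s" if s: "s \<in> V'" for s
    proof -
      have "\<phi> s = point_of (triple_at v s)"
        using in_proj_plane_eq[OF \<phi>Y v(3)] s by (auto simp: V'_def)
      then have "triple_at v0 s \<in> point_of (triple_at v s)"
        using v0(3)[of s] s by (auto simp: V'_def)
      then obtain k where k: "poly g s * poly x s = k * poly a s" "poly g s * poly y s = k * poly b s"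
          "poly g s * poly z s = k * poly c s"
        by (auto simp: point_of_def abc abc0 g)
      have "poly g s \<noteq> 0" using s by (simp add: V'_def)
      then have eq: "poly x s = k / poly g s * poly a s" "poly y s = k / poly g s * poly b s"
          "poly z s = k / poly g s * poly c s"
        using k by (simp_all add: field_simps)
      show "poly x s * poly b s = poly y s * poly a s" "poly x s * poly c s = poly z s * poly a s"
        "poly y s * poly c s = poly z s * poly b s"
        unfolding eq by simp_all
    qed
    \<comment> \<open>The cross products agree at all but finitely many parameters, hence
      identically, and therefore also at \<open>t\<close>, where \<open>g\<close> may
      vanish.\<close>
    have "x * b = y * a" "x * c = z * a" "y * c = z * b"
      by (rule poly_eqI_cofinite[OF fin]; simp add: cross)+
    then have "poly x t * poly b t = poly y t * poly a t" "poly x t * poly c t = poly z t * poly a t"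
      "poly y t * poly c t = poly z t * poly b t"
      by (metis poly_mult)+
    moreover have \<phi>t: "\<phi> t = point_of (triple_at v t) \<and> triple_at v t \<noteq> (0, 0, 0)"
      by (rule in_proj_plane_eq[OF \<phi>Y v(3)[OF v(2)]])
    ultimately have "triple_at (x, y, z) t \<in> point_of (triple_at v t)"
      using xyz[rule_format, of t] unfolding abc triple_at.simps by (intro proportional_triple) auto
    then show ?thesis
      using \<phi>t point_of_eqI by metis
  qed
  then show thesis
    using that[of "(x, y, z)"] xyz by blast
qed

text \<open>The isomorphism supplies the polynomials, and its inverse supplies regularity of the
  parameter. The curve points other than \<open>P\<close> are the values of the isomorphism.\<close>

lemma parametrization:
  fixes C :: "'a::{alg_closed_field, field_char_0} divisor"
  assumes "unicuspidal_rational_curve C P"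
  obtains F d \<phi> v where "C = div_of F" "P = point_of v" "parametrized_curve F d \<phi> v"
proof -
  obtain d F where F: "F \<in> forms d" "irreducible F" "C = div_of F"
    using assms unfolding unicuspidal_rational_curve_def plane_curve_def by blast
  have P: "P \<in> supp C"
    using assms by (simp add: unicuspidal_rational_curve_def)
  then obtain v where v: "P = point_of v" "v \<noteq> (0, 0, 0)"
    using point_of_cases supp_subset by blast
  define Y where "Y = supp C - {P}"
  have Y: "Y \<subseteq> proj_plane"
    using supp_subset by (auto simp: Y_def)
  have topY: "topspace (subtopology zariski_plane Y) = Y"
    using Y by (auto simp: topspace_zariski_plane)
  obtain \<phi> \<psi> where \<phi>: "morphism zariski_line regular_line (subtopology zariski_plane Y) regular_plane \<phi>"
    and \<psi>: "morphism (subtopology zariski_plane Y) regular_plane zariski_line regular_line \<psi>"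
    and inv: "\<forall>t. \<psi> (\<phi> t) = t" "\<forall>p\<in>Y. \<phi> (\<psi> p) = p"
  proof -
    have "isomorphic_to_affine_line Y"
      using assms by (simp add: unicuspidal_rational_curve_def Y_def)
    then show thesis
      unfolding isomorphic_to_affine_line_def by (elim exE conjE) (rule that)
  qed
  obtain w where w: "\<And>t. triple_at w t \<noteq> (0, 0, 0)" "\<And>t. \<phi> t = point_of (triple_at w t)"
    by (rule morphism_polynomial[OF \<phi> Y]) blast
  have cont: "continuous_map zariski_line (subtopology zariski_plane Y) \<phi>"
    using \<phi> by (simp add: morphism_def)
  have \<phi>Y: "\<phi> t \<in> Y" for t
    using continuous_map_funspace[OF cont] by (auto simp: topspace_zariski_line topY)
  have openin_UNIV: "openin zariski_line (UNIV :: 'a set)"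
    by (metis openin_topspace topspace_zariski_line)
  have reg: "\<exists>m G H. G \<in> forms m \<and> H \<in> forms m \<and> eval3 H (triple_at w t0) \<noteq> 0 \<and>
      [:0, 1:] * subst3 w H = subst3 w G" for t0
  proof -
    \<comment> \<open>The pullback of the identity function along the inverse is the inverse itself,
      which is thus locally a quotient of forms.\<close>
    have "regular_line UNIV (\<lambda>t::'a. t)"
      unfolding regular_line_def
    proof
      fix t :: 'a
      have "openin (subtopology zariski_line UNIV) (UNIV :: 'a set)"
        using openin_UNIV by (simp only: subtopology_UNIV)
      moreover have "\<forall>s\<in>UNIV. poly 1 s \<noteq> 0 \<and> s = poly [:0, 1:] s / poly 1 (s :: 'a)"
        by simp
      ultimately show "\<exists>V. openin (subtopology zariski_line UNIV) V \<and> t \<in> V \<and>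
          (\<exists>g h. \<forall>s\<in>V. poly h s \<noteq> 0 \<and> s = poly g s / poly h s)"
        by blast
    qed
    then have "regular_plane {x \<in> topspace (subtopology zariski_plane Y). \<psi> x \<in> UNIV} ((\<lambda>t. t) \<circ> \<psi>)"
      using openin_UNIV by (intro conjunct2[OF \<psi>[unfolded morphism_def], rule_format] conjI)
    moreover have "{x \<in> topspace (subtopology zariski_plane Y). \<psi> x \<in> UNIV} = Y"
      unfolding topY by simp
    ultimately have "regular_plane Y \<psi>"
      by (simp only: comp_def)
    from bspec[OF this[unfolded regular_plane_def] \<phi>Y[of t0]]
    obtain V n G H where V: "openin (subtopology zariski_plane Y) V" "\<phi> t0 \<in> V"
        and GH: "G \<in> forms n" "H \<in> forms n"
        "\<forall>q\<in>V. \<forall>v\<in>q. eval3 H v \<noteq> 0 \<and> \<psi> q = eval3 G v / eval3 H v"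
      by (elim exE conjE bexE) (rule that)
    define V' where "V' = {t. \<phi> t \<in> V}"
    have "openin zariski_line V'"
      using openin_continuous_map_preimage[OF cont V(1)] by (simp add: V'_def topspace_zariski_line)
    moreover have "t0 \<in> V'"
      using V(2) by (simp add: V'_def)
    ultimately have fin: "finite (- V')"
      using openin_zariski_line_cofinite by blast
    have val: "eval3 H (triple_at w t) \<noteq> 0 \<and> t = eval3 G (triple_at w t) / eval3 H (triple_at w t)"
      if "t \<in> V'" for t
    proof -
      have "\<phi> t \<in> V" "triple_at w t \<in> \<phi> t"
        using that in_point_of[of "triple_at w t"] by (simp_all only: V'_def w(2) mem_Collect_eq)
      then have "eval3 H (triple_at w t) \<noteq> 0 \<and> \<psi> (\<phi> t) = eval3 G (triple_at w t) / eval3 H (triple_at w t)"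
        using GH(3) by blast
      then show ?thesis
        unfolding inv(1)[rule_format] .
    qed
    \<comment> \<open>The quotient equals the parameter only on a neighbourhood, but this is
      cofinite, so the polynomial identity holds globally.\<close>
    have "[:0, 1:] * subst3 w H = subst3 w G"
    proof (rule poly_eqI_cofinite[OF fin])
      fix t assume "t \<in> V'"
      from val[OF this] have "t * eval3 H (triple_at w t) = eval3 G (triple_at w t)"
        by (metis nonzero_eq_divide_eq)
      then show "poly ([:0, 1:] * subst3 w H) t = poly (subst3 w G) t"
        by (simp add: poly_subst3_triple del: eval3.simps)
    qed
    then show ?thesis
      using GH(1,2) val[OF \<open>t0 \<in> V'\<close>] by blast
  qed
  have on: "point_of u \<in> supp C \<longleftrightarrow> point_of u \<in> proj_plane \<and> eval3 F u = 0" for u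
    unfolding F(3) by (rule point_of_in_supp[OF F(1)])
  have "parametrized_curve F d w v"
  proof
    fix t
    show "eval3 F (triple_at w t) = 0"
      using \<phi>Y[of t] on[of "triple_at w t"] by (simp add: Y_def w(2) del: eval3.simps)
  next
    show "eval3 F v = 0"
      using P on[of v] by (simp add: v(1) del: eval3.simps)
  next
    fix u :: "'a \<times> 'a \<times> 'a"
    assume u: "u \<noteq> (0, 0, 0)" "eval3 F u = 0"
    then have "point_of u \<in> supp C"
      unfolding on by (auto simp: proj_plane_eq)
    then consider "point_of u = P" | "point_of u = \<phi> (\<psi> (point_of u))"
      using inv(2) unfolding Y_def by fastforce
    then show "(\<exists>c. u = mult_triple c v) \<or> (\<exists>c t. u = mult_triple c (triple_at w t))"
    proof cases
      case 1
      then have "u \<in> point_of v"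
        using in_point_of[of u] by (simp add: v(1))
      then show ?thesis by (auto simp: point_of_def)
    next
      case 2
      then have "u \<in> point_of (triple_at w (\<psi> (point_of u)))"
        using in_point_of[of u] w(2) by metis
      then show ?thesis unfolding point_of_def by blast
    qed
  qed (fact F w(1) v(2) reg)+
  then show thesis
    by (rule that[OF F(3) v(1)])
qed

theorem corollary1p4:
  fixes C :: "'a::{alg_closed_field, field_char_0} divisor" and P :: "'a point"
  assumes "unicuspidal_rational_curve C P"
  shows "pencil (assoc_pencil C P) \<and> C \<in> assoc_pencil C P \<and> base_locus (assoc_pencil C P) = {P} \<and>
    (\<forall>\<Lambda>. pencil \<Lambda> \<and> C \<in> \<Lambda> \<and> base_locus \<Lambda> = {P} \<longrightarrow> \<Lambda> = assoc_pencil C P)"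
proof -
  obtain F d \<phi> v where CP: "C = div_of F" "P = point_of v" and "parametrized_curve F d \<phi> v"
    by (rule parametrization[OF assms])
  then interpret parametrized_curve F d \<phi> v by simp
  show ?thesis
    unfolding CP by (rule unique_pencil)
qed

end
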